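(* Let $G$ be a connected $d$-regular Lichnerowicz-sharp graph, and let $m_2(G)$ denote the multiplicity of the eigenvalue $2$ of $-L$ on $G$. Then there exist a graph $G'$ and an integer $r\ge m_2(G)$ such that $G$ is an $H_r$-bundle over $G'$, the graph $G'$ satisfies $\mathrm{CD}(2,\infty)$, and, if $G'$ is nontrivial (has more than one vertex), then $\lambda_1(G')>2$.
   Context: All graphs are simple, finite, connected and unweighted. For $f:V(G)\to\mathbb{R}$ put $Lf(x)=\sum_{y\sim x}(f(y)-f(x))$. The eigenvalues of $-L$ are $0=\lambda_0<\lambda_1\le\lambda_2\le\cdots$, counted with multiplicity. The Bakry--Émery operators are $2\Gamma(f,g)=L(fg)-fLg-gLf$ and $2\Gamma_2(f,g)=L\Gamma(f,g)-\Gamma(f,Lg)-\Gamma(g,Lf)$, with $\Gamma(f)=\Gamma(f,f)$ and $\Gamma_2(f)=\Gamma_2(f,f)$. $G$ satisfies $\mathrm{CD}(K,\infty)$ if $\Gamma_2(f)(x)\ge K\,\Gamma(f)(x)$ for all $f:V(G)\to\mathbb{R}$ and all $x\in V(G)$. $G$ is Lichnerowicz-sharp if, for some $K>0$, it satisfies $\mathrm{CD}(K,\infty)$ and $\lambda_1(G)=K$. $H_r$ is the $r$-dimensional hypercube: vertex set $\mathbb{F}_2^r$, two vertices adjacent iff they differ in exactly one coordinate ($H_0$ is the one-vertex graph). Graph bundles: given graphs $G',F$ and a map $\sigma$ assigning to each oriented edge $(x,y)$ of $G'$ an automorphism $\sigma_{xy}\in\operatorname{Aut}(F)$ with $\sigma_{yx}=\sigma_{xy}^{-1}$,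 the graph $G'\square_\sigma F$ has vertex set $V(G')\times V(F)$ and edges $(x,u)\sim(y,\sigma_{xy}(u))$ whenever $x\sim y$ in $G'$, and $(x,u)\sim(x,v)$ whenever $u\sim v$ in $F$. A graph is an $F$-bundle over $G'$ if it is isomorphic to $G'\square_\sigma F$ for some such $\sigma$. *)

theory Defs
  imports
    Complex_Main
    "HOL-Library.Function_Algebras"
    "HOL-Library.Multiset"
    "HOL-Library.Z2"
    "Graph_Theory.Graph_Theory"
begin

text \<open>
  A finite simple graph is a \<^locale>\<open>pair_graph\<close>: an undirected edge is represented by
  the two opposite arcs, so \<open>x \<sim> y\<close> is \<open>(x, y) \<in> parcs G\<close>.
  A function on the vertex set is a total function on the vertex type; all operators below
  depend only on its values on the vertex set when they are evaluated at a vertex.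
\<close>

definition connected_graph :: "'a pair_pre_digraph \<Rightarrow> bool" where
  "connected_graph G \<longleftrightarrow> pair_graph G \<and> Digraph_Component.connected (with_proj G)"

definition regular_graph :: "'a pair_pre_digraph \<Rightarrow> nat \<Rightarrow> bool" where
  "regular_graph G d \<longleftrightarrow> (\<forall>x \<in> pverts G. out_degree (with_proj G) x = d)"

definition Laplacian :: "'a pair_pre_digraph \<Rightarrow> ('a \<Rightarrow> real) \<Rightarrow> 'a \<Rightarrow> real" where
  "Laplacian G f x = (\<Sum>y | (x, y) \<in> parcs G. f y - f x)"

definition Gamma :: "'a pair_pre_digraph \<Rightarrow> ('a \<Rightarrow> real) \<Rightarrow> ('a \<Rightarrow> real) \<Rightarrow> 'a \<Rightarrow> real" where
  "Gamma G f g x =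
    (Laplacian G (\<lambda>y. f y * g y) x - f x * Laplacian G g x - g x * Laplacian G f x) / 2"

definition Gamma2 :: "'a pair_pre_digraph \<Rightarrow> ('a \<Rightarrow> real) \<Rightarrow> ('a \<Rightarrow> real) \<Rightarrow> 'a \<Rightarrow> real" where
  "Gamma2 G f g x =
    (Laplacian G (Gamma G f g) x - Gamma G f (Laplacian G g) x - Gamma G g (Laplacian G f) x) / 2"

definition CD_inf :: "'a pair_pre_digraph \<Rightarrow> real \<Rightarrow> bool" where
  "CD_inf G K \<longleftrightarrow> (\<forall>f. \<forall>x \<in> pverts G. Gamma2 G f f x \<ge> K * Gamma G f f x)"

interpretation fun_space: vector_space "\<lambda>(c::real) (f::'a \<Rightarrow> real) x. c * f x"
  by unfold_locales (auto simp: fun_eq_iff algebra_simps)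

text \<open>
  The functions on the vertex set are identified with the functions on the vertex type that
  vanish outside the vertex set; otherwise the arbitrary values there would contribute
  to the dimension.
\<close>

definition eigenspace :: "'a pair_pre_digraph \<Rightarrow> real \<Rightarrow> ('a \<Rightarrow> real) set" where
  "eigenspace G \<mu> =
    {f. (\<forall>x \<in> pverts G. - Laplacian G f x = \<mu> * f x) \<and> (\<forall>x. x \<notin> pverts G \<longrightarrow> f x = 0)}"

definition eigenvalues :: "'a pair_pre_digraph \<Rightarrow> real set" where
  "eigenvalues G = {\<mu>. \<exists>f \<in> eigenspace G \<mu>. f \<noteq> 0}"

definition eigenvalue_mult :: "'a pair_pre_digraph \<Rightarrow> real \<Rightarrow> nat" where
  "eigenvalue_mult G \<mu> = fun_space.dim (eigenspace G \<mu>)"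

text \<open>
  The \<open>k\<close>-th entry is the eigenvalue \<open>\<lambda>\<^sub>k\<close>, for \<open>k\<close> less than the number of vertices. In particular
  \<open>\<lambda>\<^sub>1\<close> is only meaningful for graphs with more than one vertex.
\<close>

definition spectrum_list :: "'a pair_pre_digraph \<Rightarrow> real list" where
  "spectrum_list G =
    sorted_list_of_multiset (\<Sum>\<mu> \<in> eigenvalues G. replicate_mset (eigenvalue_mult G \<mu>) \<mu>)"

definition lambda1 :: "'a pair_pre_digraph \<Rightarrow> real" where
  "lambda1 G = spectrum_list G ! 1"

definition Lichnerowicz_sharp :: "'a pair_pre_digraph \<Rightarrow> bool" where
  "Lichnerowicz_sharp G \<longleftrightarrow>
    card (pverts G) > 1 \<and> (\<exists>K > 0. CD_inf G K \<and> lambda1 G = K)"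

definition hypercube :: "nat \<Rightarrow> bit list pair_pre_digraph" where
  "hypercube r =
    \<lparr> pverts = {u. length u = r},
      parcs = {(u, v). length u = r \<and> length v = r \<and> card {i. i < r \<and> u ! i \<noteq> v ! i} = 1} \<rparr>"

text \<open>Only the restriction of an automorphism to the vertex set matters.\<close>

definition graph_automorphism :: "'a pair_pre_digraph \<Rightarrow> ('a \<Rightarrow> 'a) \<Rightarrow> bool" where
  "graph_automorphism F s \<longleftrightarrow>
    bij_betw s (pverts F) (pverts F) \<and>
    (\<forall>u \<in> pverts F. \<forall>v \<in> pverts F. (s u, s v) \<in> parcs F \<longleftrightarrow> (u, v) \<in> parcs F)"

definition bundle_data ::
  "'b pair_pre_digraph \<Rightarrow> 'c pair_pre_digraph \<Rightarrow> ('b \<Rightarrow> 'b \<Rightarrow> 'c \<Rightarrow> 'c) \<Rightarrow> bool" where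
  "bundle_data B F \<sigma> \<longleftrightarrow>
    (\<forall>(x, y) \<in> parcs B. graph_automorphism F (\<sigma> x y) \<and> (\<forall>u \<in> pverts F. \<sigma> y x (\<sigma> x y u) = u))"

definition bundle_graph ::
  "'b pair_pre_digraph \<Rightarrow> 'c pair_pre_digraph \<Rightarrow> ('b \<Rightarrow> 'b \<Rightarrow> 'c \<Rightarrow> 'c) \<Rightarrow> ('b \<times> 'c) pair_pre_digraph"
  where
  "bundle_graph B F \<sigma> =
    \<lparr> pverts = pverts B \<times> pverts F,
      parcs = {((x, u), (y, \<sigma> x y u)) | x y u. (x, y) \<in> parcs B \<and> u \<in> pverts F}
        \<union> {((x, u), (x, v)) | x u v. x \<in> pverts B \<and> (u, v) \<in> parcs F} \<rparr>"

definition is_bundle ::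
  "'a pair_pre_digraph \<Rightarrow> 'c pair_pre_digraph \<Rightarrow> 'b pair_pre_digraph \<Rightarrow> bool" where
  "is_bundle G F B \<longleftrightarrow>
    (\<exists>\<sigma>. bundle_data B F \<sigma> \<and> digraph_iso (with_proj G) (with_proj (bundle_graph B F \<sigma>)))"

end

theory Submission
  imports Defs "HOL-Analysis.Function_Topology"
begin

text \<open>
  Let \<open>\<phi>\<close> be an eigenfunction for \<open>\<lambda>\<^sub>1 = K\<close>. Since \<open>L \<phi> = - K \<phi>\<close>, the nonnegative function
  \<open>\<Gamma>\<^sub>2(\<phi>) - K \<Gamma>(\<phi>)\<close> equals \<open>L \<Gamma>(\<phi>) / 2\<close>, which sums to zero, so it vanishes at every vertex
  and \<open>\<phi>\<close> lies in the kernel of the quadratic form \<open>\<Gamma>\<^sub>2 - K \<Gamma>\<close> at every vertex. Pairing it with the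
  indicator of a vertex \<open>z\<close> turns this into a statement on common neighbours: for \<open>x \<noteq> z\<close> the sum of
  \<open>\<phi> x + \<phi> z - 2 \<phi> y\<close> over the common neighbours \<open>y\<close> vanishes, while \<open>x = z\<close> forces \<open>K = 2\<close>
  (\<open>sharp_eigenfunction_balanced\<close>, \<open>sharp_curvature_eq_2\<close>).

  Summed over neighbours, these identities say that \<open>\<phi>\<close> is harmonic for two symmetric edge weights,
  one counting triangles and one counting 4-cycles in excess of \<open>d - 1\<close>. Testing \<open>CD(2)\<close> on a
  suitable function shows that a combination of the two weights is nonnegative, so \<open>\<phi>\<close> is constant
  on every edge of positive weight. An edge on which some element of the eigenspace \<open>E\<close> of 2 is not
  constant therefore attains equality in the test, and equality is rigid (\<open>rigid_square\<close>): such an edge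
  \<open>x y\<close> lies in no triangle, each further edge \<open>x w\<close> completes it to exactly one 4-cycle
  \<open>y x w z\<close>, and all \<open>\<psi> \<in> E\<close> satisfy \<open>\<psi> x + \<psi> z = \<psi> y + \<psi> w\<close>.

  Choose \<open>h \<in> E\<close> that is constant only on those edges on which all of \<open>E\<close> is constant, and use it as
  a height. Every edge goes up, down or is flat, and the 4-cycles are diamonds. Upward diamonds make
  ascending paths confluent, so every vertex \<open>x\<close> has a unique summit \<open>top x\<close>; 4-cycles with two flat
  sides carry flat edges up and down, so \<open>top\<close> maps the flat neighbours of \<open>x\<close> bijectively onto those
  of \<open>top x\<close>. The base \<open>G'\<close> is the graph on the summits. Functions lifted along \<open>top\<close> intertwine the
  Laplacians, hence \<open>G'\<close> inherits \<open>CD(2)\<close> (\<open>CD2_base\<close>) and its eigenvalues are eigenvalues of \<open>G\<close>;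
  an eigenvalue 2 of \<open>G'\<close> would lift to an element of \<open>E\<close> that is constant on all edges
  (\<open>base_eigenvalues\<close>).

  The fibre of \<open>top\<close> over a summit \<open>t\<close> is a hypercube: label \<open>x\<close> by the set of those vertices directly
  below \<open>t\<close> that can be reached from \<open>x\<close> by ascending. The diamonds show that the labels run through
  all subsets exactly once and that adjacency in the fibre is symmetric difference of size one
  (\<open>label_structure\<close>, \<open>label_surj\<close>, \<open>adj_iff_label\<close>). Flat edges give the transition automorphisms
  (\<open>hypercube_bundle\<close>). Finally the rank is at least the multiplicity of 2, because an element of
  \<open>E\<close> is determined by its differences along the edges below one summit
  (\<open>eigenvalue_mult_le_rank\<close>).
\<close>

section \<open>Calculus with the adjacency matrix\<close>

locale connected_pair_graph =
  fixes G :: "'a pair_pre_digraph"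
  assumes conn: "connected_graph G"
begin

abbreviation "V \<equiv> pverts G"

definition adj :: "'a \<Rightarrow> 'a \<Rightarrow> bool" where
  "adj x y \<longleftrightarrow> (x, y) \<in> parcs G"

definition A :: "'a \<Rightarrow> 'a \<Rightarrow> real" where
  "A x y = (if adj x y then 1 else 0)"

sublocale pg: pair_graph G
  using conn unfolding connected_graph_def by blast

lemma finite_V [simp]: "finite V"
  by (rule pg.pair_finite_verts)

lemma adj_V: "adj x y \<Longrightarrow> x \<in> V" "adj x y \<Longrightarrow> y \<in> V"
  unfolding adj_def by (blast dest: pg.in_arcsD1 pg.in_arcsD2)+

lemma adj_sym: "adj x y \<Longrightarrow> adj y x"
  using pg.pair_sym_arcs unfolding adj_def symmetric_def by (auto dest: symD)

lemma adj_irrefl [simp]: "\<not> adj x x"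
  using pg.pair_no_loops unfolding adj_def by fastforce

lemma A_sym: "A x y = A y x"
  unfolding A_def using adj_sym by auto

lemma A_self [simp]: "A x x = 0"
  by (simp add: A_def)

lemma A_nonneg [simp]: "A x y \<ge> 0"
  by (simp add: A_def)

lemma A_mult_self [simp]: "A x y * A x y = A x y"
  by (simp add: A_def)

lemma sum_A: "(\<Sum>y\<in>V. A x y * f y) = (\<Sum>y | adj x y. f y)"
proof -
  have "(\<Sum>y\<in>V. A x y * f y) = (\<Sum>y\<in>{y. adj x y}. A x y * f y)"
    by (rule sum.mono_neutral_right) (auto simp: A_def dest: adj_V)
  also have "\<dots> = (\<Sum>y | adj x y. f y)"
    by (rule sum.cong) (auto simp: A_def)
  finally show ?thesis .
qed

lemma finite_adj [simp]: "finite {y. adj x y}"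
  by (rule finite_subset[of _ V]) (auto dest: adj_V)

lemma V_nonempty: "V \<noteq> {}"
  using conn unfolding connected_graph_def connected_def strongly_connected_def by auto

text \<open>
  The form in which connectivity is used: it spreads a property from one vertex to all others.
\<close>

lemma connected_induct:
  assumes "x \<in> V" "P x" "\<And>y z. P y \<Longrightarrow> adj y z \<Longrightarrow> P z" "y \<in> V"
  shows "P y"
proof -
  have "Digraph_Component.connected (with_proj G)"
    using conn unfolding connected_graph_def by blast
  then have "(x, y) \<in> rtrancl_on V ((parcs G)\<^sup>s)"
    using assms(1,4) by (auto simp: connected_conv)
  moreover have "(parcs G)\<^sup>s = parcs G"
    using pg.pair_sym_arcs unfolding symmetric_def by (auto simp: symcl_def sym_def)
  ultimately have "(x, y) \<in> rtrancl_on V (parcs G)" by simp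
  then show ?thesis
    by (induction rule: rtrancl_on_induct) (use assms(2,3) in \<open>auto simp: adj_def\<close>)
qed

lemma constant_on_edges:
  assumes "\<And>x y. adj x y \<Longrightarrow> f x = f y" "x \<in> V" "y \<in> V"
  shows "f x = f y"
  using connected_induct[of x "\<lambda>z. f x = f z" y] assms by metis

lemma Laplacian_eq: "Laplacian G f x = (\<Sum>y\<in>V. A x y * (f y - f x))"
  by (simp add: Laplacian_def sum_A flip: adj_def)

lemma Gamma_eq: "Gamma G f g x = (\<Sum>y\<in>V. A x y * ((f y - f x) * (g y - g x))) / 2"
  unfolding Gamma_def Laplacian_eq sum_distrib_left
  by (simp add: algebra_simps sum_subtractf sum.distrib)

lemma Laplacian_outside: "x \<notin> V \<Longrightarrow> Laplacian G f x = 0"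
  unfolding Laplacian_eq by (intro sum.neutral) (auto simp: A_def dest: adj_V)

lemma Laplacian_add_scaled:
  "Laplacian G (\<lambda>u. f u + s * g u) x = Laplacian G f x + s * Laplacian G g x"
  unfolding Laplacian_eq sum_distrib_left sum.distrib[symmetric]
  by (intro sum.cong refl) (simp add: algebra_simps)

lemma Laplacian_cong: "x \<in> V \<Longrightarrow> (\<And>y. y \<in> V \<Longrightarrow> f y = g y) \<Longrightarrow> Laplacian G f x = Laplacian G g x"
  unfolding Laplacian_eq by (intro sum.cong refl) simp

lemma Gamma_cong: "x \<in> V \<Longrightarrow> (\<And>y. y \<in> V \<Longrightarrow> f y = f' y) \<Longrightarrow> (\<And>y. y \<in> V \<Longrightarrow> g y = g' y)
    \<Longrightarrow> Gamma G f g x = Gamma G f' g' x"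
  unfolding Gamma_eq by (intro arg_cong[of _ _ "\<lambda>r. r / 2"] sum.cong refl) simp

text \<open>
  Summation by parts. The right-hand side is symmetric in \<open>f\<close> and \<open>g\<close>, and for \<open>f = g\<close> it is minus
  the Dirichlet energy.
\<close>

lemma sum_Laplacian:
  "(\<Sum>x\<in>V. g x * Laplacian G f x)
    = - (\<Sum>x\<in>V. \<Sum>y\<in>V. A x y * ((f y - f x) * (g y - g x))) / 2"
proof -
  let ?S = "\<Sum>x\<in>V. \<Sum>y\<in>V. A x y * ((f y - f x) * g x)"
  have "?S = (\<Sum>x\<in>V. \<Sum>y\<in>V. A y x * ((f x - f y) * g y))"
    by (rule sum.swap)
  also have "\<dots> = (\<Sum>x\<in>V. \<Sum>y\<in>V. A x y * ((f x - f y) * g y))"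
    by (simp add: A_sym)
  finally have "2 * ?S = (\<Sum>x\<in>V. \<Sum>y\<in>V. A x y * ((f y - f x) * g x)) + (\<Sum>x\<in>V. \<Sum>y\<in>V. A x y * ((f x - f y) * g y))"
    by simp
  also have "\<dots> = - (\<Sum>x\<in>V. \<Sum>y\<in>V. A x y * ((f y - f x) * (g y - g x)))"
    by (simp flip: sum.distrib sum_negf add: algebra_simps)
  finally have "?S = - (\<Sum>x\<in>V. \<Sum>y\<in>V. A x y * ((f y - f x) * (g y - g x))) / 2"
    by linarith
  moreover have "?S = (\<Sum>x\<in>V. g x * Laplacian G f x)"
    by (simp add: Laplacian_eq sum_distrib_left mult_ac)
  ultimately show ?thesis by simp
qed

lemma sum_Laplacian_0: "(\<Sum>x\<in>V. Laplacian G f x) = 0"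
  using sum_Laplacian[of "\<lambda>_. 1" f] by simp

lemma eigenspaceD:
  assumes "f \<in> eigenspace G \<mu>"
  shows "Laplacian G f x = - \<mu> * f x" "x \<notin> V \<Longrightarrow> f x = 0"
  using assms Laplacian_outside[of x f] unfolding eigenspace_def by (cases "x \<in> V"; auto)+

end

lemma connected_graphI:
  assumes "pair_graph G" "pverts G \<noteq> {}"
    and "\<And>x y P. x \<in> pverts G \<Longrightarrow> P x \<Longrightarrow> (\<And>y z. P y \<Longrightarrow> (y, z) \<in> parcs G \<Longrightarrow> P z) \<Longrightarrow> y \<in> pverts G \<Longrightarrow> P y"
  shows "connected_graph G"
proof -
  interpret pg: pair_graph G by fact
  have "(parcs G)\<^sup>s = parcs G"
    using pg.pair_sym_arcs unfolding symmetric_def by (auto simp: symcl_def sym_def)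
  moreover have "(x, y) \<in> rtrancl_on (pverts G) (parcs G)" if "x \<in> pverts G" "y \<in> pverts G" for x y
    by (rule assms(3)[OF that(1) _ _ that(2)])
      (use that in \<open>auto intro: rtrancl_on_into_rtrancl_on dest: pg.in_arcsD1 pg.in_arcsD2\<close>)
  ultimately show ?thesis
    unfolding connected_graph_def using assms(1,2) by (simp add: connected_conv)
qed

section \<open>The curvature form of a regular graph\<close>

locale regular_pair_graph = connected_pair_graph +
  fixes d :: nat
  assumes reg: "regular_graph G d"
begin

lemma sum_A_degree: "x \<in> V \<Longrightarrow> (\<Sum>y\<in>V. A x y) = real d"
proof -
  assume x: "x \<in> V"
  have "out_arcs (with_proj G) x = Pair x ` {y. adj x y}"
    by (auto simp: out_arcs_def adj_def)
  then have "card {y. adj x y} = d"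
    using reg x by (auto simp: regular_graph_def out_degree_def card_image inj_on_def)
  then show ?thesis using sum_A[of x "\<lambda>_. 1"] by simp
qed

text \<open>
  The polarised quadratic form \<open>4 (\<Gamma>\<^sub>2 - K \<Gamma>)\<close>. It is written with second differences along walks
  of length 2, which is the shape that \<open>\<Gamma>\<^sub>2\<close> takes when all degrees are equal to \<open>d\<close>; the
  factor 4 clears the denominators.
\<close>

definition curvature_form :: "real \<Rightarrow> 'a \<Rightarrow> ('a \<Rightarrow> real) \<Rightarrow> ('a \<Rightarrow> real) \<Rightarrow> real" where
  "curvature_form K x f g =
     (\<Sum>y\<in>V. \<Sum>z\<in>V. A x y * A y z * ((f z - 2 * f y + f x) * (g z - 2 * g y + g x)))
     - (2 * real d + 2 * K) * (\<Sum>y\<in>V. A x y * ((f y - f x) * (g y - g x)))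
     + 2 * (Laplacian G f x * Laplacian G g x)"

lemma curvature_form_eq:
  assumes x: "x \<in> V"
  shows "4 * (Gamma2 G f f x - K * Gamma G f f x) = curvature_form K x f f"
proof -
  define D where "D = (\<Sum>y\<in>V. A x y * (f y - f x)\<^sup>2)"
  have 1: "2 * Laplacian G (Gamma G f f) x = (\<Sum>y\<in>V. A x y * (\<Sum>z\<in>V. A y z * (f z - f y)\<^sup>2)) - d * D"
  proof -
    have "2 * Laplacian G (Gamma G f f) x
        = (\<Sum>y\<in>V. A x y * (2 * Gamma G f f y)) - (\<Sum>y\<in>V. A x y) * (2 * Gamma G f f x)"
      unfolding Laplacian_eq sum_distrib_left sum_distrib_right sum_subtractf[symmetric]
      by (rule sum.cong) (auto simp: algebra_simps)
    then show ?thesis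
      using sum_A_degree[OF x] by (simp add: Gamma_eq D_def power2_eq_square)
  qed
  have 2: "4 * Gamma G f (Laplacian G f) x
      = 2 * (\<Sum>y\<in>V. A x y * ((f y - f x) * (\<Sum>z\<in>V. A y z * (f z - f y)))) - 2 * (Laplacian G f x * Laplacian G f x)"
  proof -
    have "4 * Gamma G f (Laplacian G f) x
      = 2 * (\<Sum>y\<in>V. A x y * ((f y - f x) * (Laplacian G f y - Laplacian G f x)))"
      by (simp add: Gamma_eq)
    also have "\<dots> = 2 * (\<Sum>y\<in>V. A x y * ((f y - f x) * Laplacian G f y)) - 2 * ((\<Sum>y\<in>V. A x y * (f y - f x)) * Laplacian G f x)"
      by (simp only: sum_distrib_right right_diff_distrib flip: mult.assoc sum_subtractf) (simp add: sum_subtractf right_diff_distrib)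
    finally have "4 * Gamma G f (Laplacian G f) x = \<dots>" .
    then show ?thesis by (simp flip: Laplacian_eq)
  qed
  have 3: "(\<Sum>y\<in>V. \<Sum>z\<in>V. A x y * A y z * ((f z - 2 * f y + f x) * (f z - 2 * f y + f x)))
      = (\<Sum>y\<in>V. A x y * (\<Sum>z\<in>V. A y z * (f z - f y)\<^sup>2))
        - 2 * (\<Sum>y\<in>V. A x y * ((f y - f x) * (\<Sum>z\<in>V. A y z * (f z - f y)))) + d * D"
  proof -
    have dD: "d * D = (\<Sum>y\<in>V. \<Sum>z\<in>V. A x y * A y z * (f y - f x)\<^sup>2)"
      unfolding D_def sum_distrib_left
      by (intro sum.cong refl) (simp add: sum_A_degree sum_distrib_right[symmetric] sum_distrib_left[symmetric])
    show ?thesis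
      unfolding dD sum_distrib_left sum_subtractf[symmetric] sum.distrib[symmetric]
      by (intro sum.cong refl) (simp add: algebra_simps power2_eq_square)
  qed
  have 4: "4 * (Gamma2 G f f x - K * Gamma G f f x)
      = 2 * Laplacian G (Gamma G f f) x - 4 * Gamma G f (Laplacian G f) x - 2 * K * D"
  proof -
    have "Gamma G f f x = D / 2" by (simp add: Gamma_eq D_def power2_eq_square)
    then show ?thesis by (simp add: Gamma2_def field_simps)
  qed
  have D: "D = (\<Sum>y\<in>V. A x y * ((f y - f x) * (f y - f x)))"
    by (simp add: D_def power2_eq_square)
  show ?thesis
    unfolding 4 curvature_form_def 1 2 3 D[symmetric] by (simp add: algebra_simps)
qed

lemma curvature_form_expand:
  "curvature_form K x (\<lambda>u. f u + s * g u) (\<lambda>u. f u + s * g u)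
   = curvature_form K x f f + 2 * s * curvature_form K x f g + s\<^sup>2 * curvature_form K x g g"
proof -
  have 1: "(\<Sum>y\<in>V. \<Sum>z\<in>V. A x y * A y z * (((f z + s * g z) - 2 * (f y + s * g y) + (f x + s * g x)) * ((f z + s * g z) - 2 * (f y + s * g y) + (f x + s * g x))))
    = (\<Sum>y\<in>V. \<Sum>z\<in>V. A x y * A y z * ((f z - 2 * f y + f x) * (f z - 2 * f y + f x)))
    + 2 * s * (\<Sum>y\<in>V. \<Sum>z\<in>V. A x y * A y z * ((f z - 2 * f y + f x) * (g z - 2 * g y + g x)))
    + s\<^sup>2 * (\<Sum>y\<in>V. \<Sum>z\<in>V. A x y * A y z * ((g z - 2 * g y + g x) * (g z - 2 * g y + g x)))"
    unfolding sum_distrib_left sum.distrib[symmetric]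
    by (intro sum.cong refl) (simp add: algebra_simps power2_eq_square)
  have 2: "(\<Sum>y\<in>V. A x y * (((f y + s * g y) - (f x + s * g x)) * ((f y + s * g y) - (f x + s * g x))))
    = (\<Sum>y\<in>V. A x y * ((f y - f x) * (f y - f x))) + 2 * s * (\<Sum>y\<in>V. A x y * ((f y - f x) * (g y - g x)))
    + s\<^sup>2 * (\<Sum>y\<in>V. A x y * ((g y - g x) * (g y - g x)))"
    unfolding sum_distrib_left sum.distrib[symmetric]
    by (intro sum.cong refl) (simp add: algebra_simps power2_eq_square)
  have 3: "Laplacian G (\<lambda>u. f u + s * g u) x = Laplacian G f x + s * Laplacian G g x"
    by (rule Laplacian_add_scaled)
  show ?thesis
    unfolding curvature_form_def 1 2 3 by (simp add: algebra_simps power2_eq_square)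
qed

end

text \<open>
  The first-order condition at a minimum, for functions along a line.
\<close>

lemma nonneg_quadratic_imp_linear_0:
  fixes b c :: real
  assumes "\<And>s. 0 \<le> s * b + s\<^sup>2 * c"
  shows "b = 0"
proof (rule ccontr)
  assume "b \<noteq> 0"
  \<comment> \<open>The step goes against the sign of \<open>b\<close>, and its size keeps the quadratic term below the linear one.\<close>
  define s where "s = - b / (\<bar>c\<bar> + 1)"
  have pos: "\<bar>c\<bar> + 1 > 0" by linarith
  have "s * b + s\<^sup>2 * c \<le> s * b + s\<^sup>2 * \<bar>c\<bar>"
    by (simp add: mult_left_mono)
  also have "\<dots> = - b\<^sup>2 / (\<bar>c\<bar> + 1)\<^sup>2"
  proof -
    have "b = - s * (\<bar>c\<bar> + 1)" using pos by (simp add: s_def)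
    then have "s * b + s\<^sup>2 * \<bar>c\<bar> = - s\<^sup>2" by (simp add: power2_eq_square algebra_simps) algebra
    then show ?thesis by (simp add: s_def power_divide)
  qed
  also have "\<dots> < 0"
    using \<open>b \<noteq> 0\<close> pos by simp
  finally show False using assms[of s] by linarith
qed

context regular_pair_graph
begin

text \<open>
  The number of common neighbours, as the entry of the squared adjacency matrix.
\<close>

definition common :: "'a \<Rightarrow> 'a \<Rightarrow> real" where
  "common x z = (\<Sum>y\<in>V. A x y * A y z)"

lemma Laplacian_regular:
  "x \<in> V \<Longrightarrow> Laplacian G f x = (\<Sum>y\<in>V. A x y * f y) - real d * f x"
  by (simp add: Laplacian_eq algebra_simps sum_subtractf sum_A_degree sum_distrib_left[symmetric])

text \<open>
  For an eigenfunction to the eigenvalue \<open>K\<close> one has \<open>\<Gamma>\<^sub>2(\<phi>) - K \<Gamma>(\<phi>) = L \<Gamma>(\<phi>) / 2\<close>. Its sum over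
  all vertices is 0 while \<open>CD(K)\<close> makes every summand nonnegative, so it vanishes identically. Hence
  \<open>\<phi>\<close> minimises the form at every vertex \<open>x\<close> and its pairing with every function is 0; the statement
  is this pairing with the indicator of \<open>z\<close>, in which all terms except the sum over common
  neighbours cancel when \<open>z \<noteq> x\<close>.
\<close>

lemma sharp_eigenfunction_balanced:
  assumes CD: "CD_inf G K" and eig: "\<phi> \<in> eigenspace G K" and x: "x \<in> V" and z: "z \<in> V"
  shows "(\<Sum>y\<in>V. A x y * A y z * (\<phi> x + \<phi> z - 2 * \<phi> y)) = (if z = x then K\<^sup>2 * \<phi> x else 0)"
proof -
  have L: "Laplacian G \<phi> u = - K * \<phi> u" for u
    using eigenspaceD(1)[OF eig] .
  have LF: "Laplacian G \<phi> = (\<lambda>u. - K * \<phi> u)" using L by auto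
  have nonneg: "curvature_form K u f f \<ge> 0" if "u \<in> V" for u f
    using CD that unfolding curvature_form_eq[OF that, symmetric] CD_inf_def by auto
  have G2: "Gamma2 G \<phi> \<phi> u - K * Gamma G \<phi> \<phi> u = Laplacian G (Gamma G \<phi> \<phi>) u / 2" for u
  proof -
    have "Gamma G \<phi> (Laplacian G \<phi>) u = - K * Gamma G \<phi> \<phi> u"
      unfolding Gamma_eq LF sum_distrib_left times_divide_eq_right
      by (intro arg_cong[of _ _ "\<lambda>r. r / 2"] sum.cong refl) (simp add: algebra_simps)
    then show ?thesis by (simp add: Gamma2_def add_divide_distrib)
  qed
  have "(\<Sum>u\<in>V. curvature_form K u \<phi> \<phi>) = (\<Sum>u\<in>V. 2 * Laplacian G (Gamma G \<phi> \<phi>) u)"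
    by (intro sum.cong refl) (simp add: curvature_form_eq[symmetric] G2)
  also have "\<dots> = 0"
    using sum_Laplacian_0[of "Gamma G \<phi> \<phi>"] by (simp flip: sum_distrib_left)
  finally have zero: "curvature_form K x \<phi> \<phi> = 0"
    using sum_nonneg_eq_0_iff[of V "\<lambda>u. curvature_form K u \<phi> \<phi>"] nonneg x by auto
  \<comment> \<open>Perturbing the minimiser \<open>\<phi>\<close> in the direction of the indicator of \<open>z\<close> kills the mixed term.\<close>
  define \<delta> where "\<delta> = (\<lambda>u. if u = z then 1 else 0 :: real)"
  have "0 \<le> s * (2 * curvature_form K x \<phi> \<delta>) + s\<^sup>2 * curvature_form K x \<delta> \<delta>" for s
    using nonneg[OF x, of "\<lambda>u. \<phi> u + s * \<delta> u"] unfolding curvature_form_expand zero by simp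
  then have pair0: "curvature_form K x \<phi> \<delta> = 0"
    using nonneg_quadratic_imp_linear_0 by fastforce
  define T where "T = (\<lambda>y w. \<phi> w - 2 * \<phi> y + \<phi> x)"
  have sel: "(\<Sum>w\<in>V. h w * \<delta> w) = h z" for h :: "'a \<Rightarrow> real"
  proof -
    have "(\<Sum>w\<in>V. h w * \<delta> w) = (\<Sum>w\<in>V. if w = z then h z else 0)"
      by (intro sum.cong refl) (auto simp: \<delta>_def)
    then show ?thesis using z by simp
  qed
  have sumT: "(\<Sum>w\<in>V. A u w * T u w) = - K * \<phi> u - real d * \<phi> u + real d * \<phi> x" if "u \<in> V" for u
  proof -
    have "(\<Sum>w\<in>V. A u w * T u w) = Laplacian G \<phi> u + (\<Sum>w\<in>V. A u w) * (\<phi> x - \<phi> u)"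
      unfolding Laplacian_eq sum_distrib_right sum.distrib[symmetric]
      by (intro sum.cong refl) (simp add: T_def algebra_simps)
    then show ?thesis using L sum_A_degree[OF that] by (simp add: algebra_simps)
  qed
  \<comment> \<open>Each of the three occurrences of \<open>\<delta>\<close> selects \<open>z\<close> as the end point, the midpoint or the
      start of the walk \<open>x y w\<close>.\<close>
  have A: "(\<Sum>y\<in>V. \<Sum>w\<in>V. A x y * A y w * (T y w * (\<delta> w - 2 * \<delta> y + \<delta> x)))
     = (\<Sum>y\<in>V. A x y * A y z * T y z) - 2 * (A x z * (\<Sum>w\<in>V. A z w * T z w))
       + \<delta> x * (\<Sum>y\<in>V. \<Sum>w\<in>V. A x y * A y w * T y w)"
  proof -
    have "(\<Sum>y\<in>V. \<Sum>w\<in>V. A x y * A y w * (T y w * (\<delta> w - 2 * \<delta> y + \<delta> x)))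
      = (\<Sum>y\<in>V. \<Sum>w\<in>V. (A x y * A y w * T y w) * \<delta> w)
        - 2 * (\<Sum>y\<in>V. (A x y * (\<Sum>w\<in>V. A y w * T y w)) * \<delta> y)
        + \<delta> x * (\<Sum>y\<in>V. \<Sum>w\<in>V. A x y * A y w * T y w)"
      unfolding sum_distrib_left sum_distrib_right sum_subtractf[symmetric] sum.distrib[symmetric]
      by (intro sum.cong refl) (simp add: algebra_simps)
    then show ?thesis unfolding sel .
  qed
  have B: "(\<Sum>y\<in>V. \<Sum>w\<in>V. A x y * A y w * T y w) = K\<^sup>2 * \<phi> x"
  proof -
    have "(\<Sum>y\<in>V. \<Sum>w\<in>V. A x y * A y w * T y w) = (\<Sum>y\<in>V. A x y * (\<Sum>w\<in>V. A y w * T y w))"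
      by (simp add: sum_distrib_left mult.assoc)
    also have "\<dots> = (\<Sum>y\<in>V. A x y * (- K * \<phi> y - real d * \<phi> y + real d * \<phi> x))"
      by (intro sum.cong refl) (simp add: sumT)
    also have "\<dots> = - (K + real d) * (\<Sum>y\<in>V. A x y * \<phi> y) + (\<Sum>y\<in>V. A x y) * (real d * \<phi> x)"
      unfolding sum_distrib_left sum_distrib_right sum.distrib[symmetric]
      by (intro sum.cong refl) (simp add: algebra_simps)
    also have "(\<Sum>y\<in>V. A x y * \<phi> y) = real d * \<phi> x - K * \<phi> x"
      using Laplacian_regular[OF x, of \<phi>] L[of x] by simp
    finally show ?thesis using sum_A_degree[OF x] by (simp add: algebra_simps power2_eq_square)
  qed
  have C: "(\<Sum>y\<in>V. A x y * ((\<phi> y - \<phi> x) * (\<delta> y - \<delta> x))) = A x z * (\<phi> z - \<phi> x) + \<delta> x * (K * \<phi> x)"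
  proof -
    have "(\<Sum>y\<in>V. A x y * ((\<phi> y - \<phi> x) * (\<delta> y - \<delta> x)))
       = (\<Sum>y\<in>V. (A x y * (\<phi> y - \<phi> x)) * \<delta> y) - \<delta> x * (\<Sum>y\<in>V. A x y * (\<phi> y - \<phi> x))"
      unfolding sum_distrib_left sum_subtractf[symmetric]
      by (intro sum.cong refl) (simp add: algebra_simps)
    then show ?thesis unfolding sel using L[of x] by (simp flip: Laplacian_eq)
  qed
  have D: "Laplacian G \<delta> x = A x z - real d * \<delta> x"
    using Laplacian_regular[OF x, of \<delta>] unfolding sel .
  have "(\<Sum>y\<in>V. A x y * A y z * T y z) = \<delta> x * K\<^sup>2 * \<phi> x"
    using pair0 unfolding curvature_form_def T_def[symmetric]
    unfolding A[unfolded T_def] B[unfolded T_def] sumT[OF z, unfolded T_def] C D L T_def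
    by (simp add: algebra_simps power2_eq_square)
  then show ?thesis by (simp add: T_def \<delta>_def algebra_simps)
qed

text \<open>
  In the balance identity at \<open>z = x\<close> every neighbour is a common neighbour, so the left-hand side
  is \<open>- 2 L \<phi> = 2 K \<phi>\<close>, to be compared with \<open>K\<^sup>2 \<phi>\<close>.
\<close>

lemma sharp_curvature_eq_2:
  assumes CD: "CD_inf G K" and eig: "\<phi> \<in> eigenspace G K" and x: "\<phi> x \<noteq> 0" and K: "K > 0"
  shows "K = 2"
proof -
  have xV: "x \<in> V" using eigenspaceD(2)[OF eig] x by blast
  have "K\<^sup>2 * \<phi> x = (\<Sum>y\<in>V. A x y * A y x * (\<phi> x + \<phi> x - 2 * \<phi> y))"
    using sharp_eigenfunction_balanced[OF CD eig xV xV] by simp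
  also have "\<dots> = - 2 * Laplacian G \<phi> x"
    unfolding Laplacian_eq sum_distrib_left
    by (intro sum.cong refl) (simp add: A_sym[of _ x] algebra_simps)
  also have "\<dots> = 2 * K * \<phi> x"
    using eigenspaceD(1)[OF eig] by simp
  finally show ?thesis using x K by (simp add: power2_eq_square)
qed

text \<open>
  The entry of the cubed adjacency matrix. If \<open>x\<close> and \<open>y\<close> are adjacent, \<open>2 d - 1\<close> of these walks
  backtrack (they return to \<open>x\<close> after two steps or reach \<open>y\<close> after one), and the remaining ones
  correspond to the 4-cycles through the edge. The value \<open>3 d - 2\<close> that plays a role below
  therefore means that the edge lies on \<open>d - 1\<close> such cycles.
\<close>

definition walks3 :: "'a \<Rightarrow> 'a \<Rightarrow> real" where
  "walks3 x y = (\<Sum>z\<in>V. common x z * A z y)"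

lemma common_sym: "common x z = common z x"
  unfolding common_def by (intro sum.cong refl) (simp add: A_sym)

lemma walks3_sym: "walks3 x y = walks3 y x"
proof -
  have "walks3 x y = (\<Sum>z\<in>V. \<Sum>u\<in>V. A x u * A u z * A z y)"
    by (simp add: walks3_def common_def sum_distrib_right)
  also have "\<dots> = (\<Sum>u\<in>V. \<Sum>z\<in>V. A x u * A u z * A z y)"
    by (rule sum.swap)
  also have "\<dots> = (\<Sum>u\<in>V. \<Sum>z\<in>V. A y z * A z u * A u x)"
    by (intro sum.cong refl) (simp add: A_sym mult_ac)
  also have "\<dots> = walks3 y x"
    by (simp add: walks3_def common_def sum_distrib_right)
  finally show ?thesis .
qed

lemma common_self: "x \<in> V \<Longrightarrow> common x x = d"
  unfolding common_def using sum_A_degree[of x] by (simp add: A_sym[of _ x])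

lemma common_nonneg: "common x z \<ge> 0"
  unfolding common_def by (intro sum_nonneg) auto

lemma walks3_nonneg: "walks3 x z \<ge> 0"
  unfolding walks3_def by (intro sum_nonneg mult_nonneg_nonneg common_nonneg) auto

lemma common_card: "common x z = card {y. adj x y \<and> adj y z}"
proof -
  have "common x z = (\<Sum>y | adj x y. A y z)"
    unfolding common_def by (rule sum_A)
  also have "\<dots> = (\<Sum>y\<in>{y. adj x y \<and> adj y z}. 1)"
    unfolding A_def by (subst sum.inter_filter[symmetric]) (auto intro!: sum.cong)
  finally show ?thesis by simp
qed

lemma common_ge_1: "common x z \<noteq> 0 \<Longrightarrow> common x z \<ge> 1"
  unfolding common_card by (cases "card {y. adj x y \<and> adj y z}") auto

end

section \<open>Rigidity of 4-cycles\<close>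

locale regular_CD2_graph = regular_pair_graph +
  assumes CD2: "CD_inf G 2"
begin

abbreviation "E \<equiv> eigenspace G 2"

lemma common_neighbours_balanced:
  assumes "\<phi> \<in> E" "x \<in> V" "z \<in> V"
  shows "(\<Sum>y\<in>V. A x y * A y z * (\<phi> x + \<phi> z - 2 * \<phi> y)) = (if z = x then 4 * \<phi> x else 0)"
  using sharp_eigenfunction_balanced[OF CD2 assms] by simp

text \<open>
  The balance identity for \<open>x\<close> and a neighbour \<open>z\<close>, summed over \<open>z\<close>, runs over the triangles
  \<open>x y z\<close>. Exchanging \<open>y\<close> and \<open>z\<close> shows that its terms combine to a multiple of one sum.
\<close>

lemma harmonic_for_triangles:
  assumes E: "\<phi> \<in> E" and x: "x \<in> V"
  shows "(\<Sum>y\<in>V. A x y * common x y * (\<phi> y - \<phi> x)) = 0"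
proof -
  let ?T = "\<Sum>y\<in>V. A x y * common x y * (\<phi> y - \<phi> x)"
  have "0 = (\<Sum>z\<in>V. A x z * (\<Sum>y\<in>V. A x y * A y z * (\<phi> x + \<phi> z - 2 * \<phi> y)))"
    by (intro sum.neutral[symmetric]) (auto simp: common_neighbours_balanced[OF E x])
  also have "\<dots> = (\<Sum>z\<in>V. \<Sum>y\<in>V. A x z * (A x y * A y z) * (\<phi> z - \<phi> x))
      - 2 * (\<Sum>z\<in>V. \<Sum>y\<in>V. A x z * (A x y * A y z) * (\<phi> y - \<phi> x))"
    unfolding sum_distrib_left sum_subtractf[symmetric]
    by (intro sum.cong refl) (simp add: algebra_simps)
  also have "(\<Sum>z\<in>V. \<Sum>y\<in>V. A x z * (A x y * A y z) * (\<phi> z - \<phi> x)) = ?T"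
    unfolding common_def sum_distrib_left sum_distrib_right by simp
  also have "(\<Sum>z\<in>V. \<Sum>y\<in>V. A x z * (A x y * A y z) * (\<phi> y - \<phi> x)) = ?T"
    unfolding common_def sum_distrib_left sum_distrib_right
    by (subst sum.swap) (simp add: A_sym mult_ac)
  finally show ?thesis by simp
qed

text \<open>
  The balance identity is summed over all pairs \<open>y, w\<close> of neighbours of \<open>x\<close>, that is, over closed
  walks \<open>x y u w\<close>. Regrouped by the opposite vertex \<open>u\<close>, the sum contains the number \<open>c\<close> of
  common neighbours of \<open>x\<close> and \<open>u\<close> quadratically; the balance identity for \<open>x\<close> and \<open>u\<close>
  linearises it, and what remains is a sum over walks of length 3 that start at \<open>x\<close>.
\<close>

lemma harmonic_for_squares:
  assumes E: "\<phi> \<in> E" and x: "x \<in> V"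
  shows "(\<Sum>y\<in>V. A x y * (walks3 x y - (3 * real d - 2)) * (\<phi> y - \<phi> x)) = 0"
proof -
  \<comment> \<open>Balance is invariant under adding constants except for its diagonal value, so \<open>\<phi>\<close> may be
      normalised to vanish at \<open>x\<close>; \<open>h u\<close> sums this normalisation over the common neighbours of
      \<open>x\<close> and \<open>u\<close>.\<close>
  define f where "f = (\<lambda>u. \<phi> u - \<phi> x)"
  define h where "h = (\<lambda>u. \<Sum>y\<in>V. A x y * A y u * f y)"
  have fx: "f x = 0" by (simp add: f_def)
  have Lf: "(\<Sum>y\<in>V. A x y * f y) = - 2 * \<phi> x"
    using eigenspaceD(1)[OF E, of x] by (simp add: Laplacian_eq f_def)
  have hx: "h x = - 2 * \<phi> x"
    unfolding h_def using Lf by (simp add: A_sym[of _ x])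
  have S1: "common x u * f u = 2 * h u + (if u = x then 4 * \<phi> x else 0)" if u: "u \<in> V" for u
  proof -
    have "(\<Sum>y\<in>V. A x y * A y u * (\<phi> x + \<phi> u - 2 * \<phi> y)) = common x u * f u - 2 * h u"
      unfolding common_def h_def f_def sum_distrib_left sum_distrib_right sum_subtractf[symmetric]
      by (intro sum.cong refl) (simp add: algebra_simps)
    then show ?thesis using common_neighbours_balanced[OF E x u] by simp
  qed
  have S2: "(\<Sum>u\<in>V. A y u * A u w * (f y + f w - 2 * f u)) = (if w = y then 4 * \<phi> y else 0)"
    if "y \<in> V" "w \<in> V" for y w
    using common_neighbours_balanced[OF E that] by (simp add: f_def algebra_simps)
  let ?c = "common x"
  have "(\<Sum>y\<in>V. \<Sum>w\<in>V. A x y * A x w * (\<Sum>u\<in>V. A y u * A u w * (f y + f w - 2 * f u)))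
      = (\<Sum>y\<in>V. \<Sum>w\<in>V. if w = y then 4 * (A x y * \<phi> y) else 0)"
    by (intro sum.cong refl) (simp add: S2)
  also have "\<dots> = 4 * (\<Sum>y\<in>V. A x y * \<phi> y)"
    by (simp add: sum_distrib_left)
  also have "(\<Sum>y\<in>V. A x y * \<phi> y) = (real d - 2) * \<phi> x"
    using Laplacian_regular[OF x, of \<phi>] eigenspaceD(1)[OF E, of x] by (simp add: algebra_simps)
  finally have rhs: "(\<Sum>y\<in>V. \<Sum>w\<in>V. A x y * A x w * (\<Sum>u\<in>V. A y u * A u w * (f y + f w - 2 * f u)))
      = 4 * ((real d - 2) * \<phi> x)" .
  have "(\<Sum>y\<in>V. \<Sum>w\<in>V. A x y * A x w * (\<Sum>u\<in>V. A y u * A u w * (f y + f w - 2 * f u)))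
      = (\<Sum>y\<in>V. \<Sum>w\<in>V. \<Sum>u\<in>V. (A x y * A y u) * (A x w * A w u) * (f y + f w - 2 * f u))"
    unfolding sum_distrib_left by (intro sum.cong refl) (simp add: A_sym mult_ac)
  also have "\<dots> = (\<Sum>u\<in>V. \<Sum>y\<in>V. \<Sum>w\<in>V. (A x y * A y u) * (A x w * A w u) * (f y + f w - 2 * f u))"
    by (subst (2) sum.swap, subst sum.swap) (rule refl)
  also have "\<dots> = (\<Sum>u\<in>V. h u * ?c u + ?c u * h u - 2 * (?c u * ?c u * f u))"
  proof (intro sum.cong refl)
    fix u
    have e1: "h u * ?c u = (\<Sum>y\<in>V. \<Sum>w\<in>V. (A x y * A y u * f y) * (A x w * A w u))"
      unfolding h_def common_def by (rule sum_product)
    have e2: "?c u * h u = (\<Sum>y\<in>V. \<Sum>w\<in>V. (A x y * A y u) * (A x w * A w u * f w))"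
      unfolding h_def common_def by (rule sum_product)
    have e3: "2 * (?c u * ?c u * f u) = (\<Sum>y\<in>V. \<Sum>w\<in>V. 2 * ((A x y * A y u) * (A x w * A w u) * f u))"
      unfolding common_def sum_product sum_distrib_left sum_distrib_right by (simp add: mult_ac)
    show "(\<Sum>y\<in>V. \<Sum>w\<in>V. (A x y * A y u) * (A x w * A w u) * (f y + f w - 2 * f u))
        = h u * ?c u + ?c u * h u - 2 * (?c u * ?c u * f u)"
      unfolding e1 e2 e3 sum.distrib[symmetric] sum_subtractf[symmetric]
      by (intro sum.cong refl) (simp add: algebra_simps)
  qed
  \<comment> \<open>\<open>S1\<close> replaces one factor in \<open>c\<^sup>2 f\<close>: the product \<open>c f\<close> is \<open>2 h\<close> away from \<open>x\<close>.\<close>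
  also have "\<dots> = (\<Sum>u\<in>V. - 2 * (?c u * h u) + (if u = x then - 8 * ?c x * \<phi> x else 0))"
  proof (intro sum.cong refl)
    fix u assume "u \<in> V"
    have "h u * ?c u + ?c u * h u - 2 * (?c u * ?c u * f u) = 2 * (?c u * h u) - 2 * (?c u * (?c u * f u))"
      by simp
    also have "\<dots> = - 2 * (?c u * h u) + (if u = x then - 8 * ?c x * \<phi> x else 0)"
      unfolding S1[OF \<open>u \<in> V\<close>] by (simp add: algebra_simps)
    finally show "h u * ?c u + ?c u * h u - 2 * (?c u * ?c u * f u)
      = - 2 * (?c u * h u) + (if u = x then - 8 * ?c x * \<phi> x else 0)" .
  qed
  also have "\<dots> = - 2 * (\<Sum>u\<in>V. ?c u * h u) - 8 * d * \<phi> x"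
    unfolding sum.distrib using x common_self[OF x] by (simp add: sum_distrib_left sum_negf)
  also have "(\<Sum>u\<in>V. ?c u * h u) = (\<Sum>y\<in>V. A x y * walks3 x y * f y)"
    unfolding h_def walks3_def sum_distrib_left sum_distrib_right
    by (subst sum.swap) (intro sum.cong refl, simp add: A_sym mult_ac)
  finally have "(\<Sum>y\<in>V. A x y * walks3 x y * f y) = - (2 * (3 * real d - 2)) * \<phi> x"
    using rhs by (simp add: algebra_simps)
  moreover have "(\<Sum>y\<in>V. A x y * (walks3 x y - (3 * real d - 2)) * f y)
     = (\<Sum>y\<in>V. A x y * walks3 x y * f y) - (3 * real d - 2) * (\<Sum>y\<in>V. A x y * f y)"
    unfolding sum_distrib_left sum_subtractf[symmetric]
    by (intro sum.cong refl) (simp add: algebra_simps)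
  ultimately show ?thesis
    unfolding Lf by (simp add: f_def) (simp add: algebra_simps)
qed

text \<open>
  \<open>CD(2)\<close> at \<open>x\<close> for a function that is 1 at \<open>y\<close>, takes arbitrary values \<open>\<theta>\<close> on the other
  neighbours of \<open>y\<close> and vanishes elsewhere. Because the edge lies in no triangle, \<open>y\<close> is the only
  neighbour of \<open>x\<close> in the support, and a vertex \<open>z\<close> beyond the edge is seen once through \<open>y\<close> and
  \<open>common x z - 1\<close> times through other neighbours of \<open>x\<close>.
\<close>

lemma CD2_edge_test:
  assumes xy: "adj x y" and tri: "common x y = 0"
  shows "2 * real d - 2 \<le> (\<Sum>z\<in>{z. adj y z} - {x}. (\<theta> z - 2)\<^sup>2 + (common x z - 1) * (\<theta> z)\<^sup>2)"
proof -
  have x: "x \<in> V" and y: "y \<in> V" using adj_V[OF xy] by auto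
  have yx: "adj y x" using xy adj_sym by blast
  have no_tri: "\<not> (adj x u \<and> adj u y)" for u
    using tri unfolding common_card by auto
  define F where "F = (\<lambda>u. if u = y then 1 else if adj y u \<and> u \<noteq> x then \<theta> u else 0)"
  have Fx: "F x = 0" using xy by (auto simp: F_def)
  have Fy: "F y = 1" by (simp add: F_def)
  have Fnb: "F u = 0" if "adj x u" "u \<noteq> y" for u
    using that no_tri[of u] adj_sym unfolding F_def by auto
  have nonneg: "curvature_form 2 x F F \<ge> 0"
    using CD2 x unfolding curvature_form_eq[OF x, symmetric] CD_inf_def by auto
  have grad: "(\<Sum>u\<in>V. A x u * (F u * F u)) = 1"
  proof -
    have "(\<Sum>u\<in>V. A x u * (F u * F u)) = (\<Sum>u\<in>V. if u = y then 1 else 0)"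
      by (intro sum.cong refl) (use Fnb xy Fy in \<open>auto simp: A_def\<close>)
    then show ?thesis using y by simp
  qed
  have lap: "Laplacian G F x = 1"
  proof -
    have "Laplacian G F x = (\<Sum>u\<in>V. if u = y then 1 else 0)"
      unfolding Laplacian_eq by (intro sum.cong refl) (use Fnb xy Fx Fy in \<open>auto simp: A_def\<close>)
    then show ?thesis using y by simp
  qed
  let ?N = "{z. adj y z} - {x}"
  define S where "S = (\<lambda>u. \<Sum>z\<in>V. A u z * (F z - 2 * F u)\<^sup>2)"
  \<comment> \<open>The 4 comes from the walk that returns from \<open>y\<close> to \<open>x\<close>.\<close>
  have Sy: "S y = 4 + (\<Sum>z\<in>?N. (\<theta> z - 2)\<^sup>2)"
  proof -
    have "S y = (\<Sum>z | adj y z. (F z - 2)\<^sup>2)"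
      unfolding S_def Fy by (subst sum_A) simp
    also have "\<dots> = (F x - 2)\<^sup>2 + (\<Sum>z\<in>?N. (F z - 2)\<^sup>2)"
      by (rule sum.remove) (use yx in auto)
    also have "(\<Sum>z\<in>?N. (F z - 2)\<^sup>2) = (\<Sum>z\<in>?N. (\<theta> z - 2)\<^sup>2)"
      by (intro sum.cong refl) (auto simp: F_def)
    finally show ?thesis by (simp add: Fx)
  qed
  have So: "(\<Sum>u\<in>V - {y}. A x u * S u) = (\<Sum>z\<in>?N. (common x z - 1) * (\<theta> z)\<^sup>2)"
  proof -
    have "(\<Sum>u\<in>V - {y}. A x u * S u) = (\<Sum>u\<in>V - {y}. \<Sum>z\<in>V. A x u * A u z * (F z)\<^sup>2)"
      unfolding S_def sum_distrib_left
      by (intro sum.cong refl) (use Fnb in \<open>auto simp: A_def\<close>)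
    also have "\<dots> = (\<Sum>z\<in>V. (\<Sum>u\<in>V - {y}. A x u * A u z) * (F z)\<^sup>2)"
      by (subst sum.swap) (simp add: sum_distrib_right)
    also have "\<dots> = (\<Sum>z\<in>V. (common x z - A y z) * (F z)\<^sup>2)"
      unfolding common_def using y xy by (intro sum.cong refl) (simp add: sum.remove[of V y] A_def)
    also have "\<dots> = (\<Sum>z\<in>?N. (common x z - A y z) * (F z)\<^sup>2)"
      by (rule sum.mono_neutral_right) (auto simp: F_def tri dest: adj_V)
    also have "\<dots> = (\<Sum>z\<in>?N. (common x z - 1) * (\<theta> z)\<^sup>2)"
      by (intro sum.cong refl) (auto simp: F_def A_def)
    finally show ?thesis .
  qed
  have "(\<Sum>u\<in>V. \<Sum>z\<in>V. A x u * A u z * ((F z - 2 * F u + F x) * (F z - 2 * F u + F x))) = (\<Sum>u\<in>V. A x u * S u)"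
    unfolding S_def sum_distrib_left Fx by (simp add: power2_eq_square mult.assoc)
  also have "\<dots> = S y + (\<Sum>u\<in>V - {y}. A x u * S u)"
    using y xy by (simp add: sum.remove[of V y] A_def)
  finally have "curvature_form 2 x F F
     = 4 + (\<Sum>z\<in>?N. (\<theta> z - 2)\<^sup>2) + (\<Sum>z\<in>?N. (common x z - 1) * (\<theta> z)\<^sup>2) - (2 * real d + 4) + 2"
    unfolding curvature_form_def Sy So using grad lap by (simp add: Fx)
  then show ?thesis using nonneg by (simp add: sum.distrib)
qed

lemma sum_common_beyond_edge:
  assumes xy: "adj x y"
  shows "(\<Sum>z\<in>{z. adj y z} - {x}. common x z) = walks3 x y - d"
proof -
  have "walks3 x y = (\<Sum>z | adj y z. common x z)"
    using sum_A[of y "common x"] unfolding walks3_def by (simp add: A_sym[of _ y] mult.commute)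
  also have "\<dots> = common x x + (\<Sum>z\<in>{z. adj y z} - {x}. common x z)"
    by (rule sum.remove) (use adj_sym[OF xy] in auto)
  finally show ?thesis using common_self adj_V[OF xy] by simp
qed

lemma walks3_lower_bound:
  assumes xy: "adj x y" and tri: "common x y = 0"
  shows "3 * real d - 2 \<le> walks3 x y"
  using CD2_edge_test[OF assms, of "\<lambda>_. 1"] sum_common_beyond_edge[OF xy] by simp

text \<open>
  For \<open>c = common x z\<close> the summand \<open>(\<theta> - 2)\<^sup>2 + (c - 1) \<theta>\<^sup>2\<close> of the edge test is smallest at
  \<open>\<theta> = 2 / c\<close>, with value \<open>c - (c - 2)\<^sup>2 / c\<close>. If the walk count attains its lower bound, the
  terms \<open>c\<close> already add up to the left-hand side of the test, so every \<open>(c - 2)\<^sup>2 / c\<close> must be 0.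
\<close>

lemma common_eq_2:
  assumes xy: "adj x y" and tri: "common x y = 0" and w3: "walks3 x y = 3 * real d - 2"
    and yz: "adj y z" and zx: "z \<noteq> x"
  shows "common x z = 2"
proof -
  let ?N = "{z. adj y z} - {x}"
  have pos: "common x u \<ge> 1" if "u \<in> ?N" for u
  proof -
    have "y \<in> {v. adj x v \<and> adj v u}" using that xy by auto
    then have "card {v. adj x v \<and> adj v u} > 0"
      by (intro card_gt_0_iff[THEN iffD2]) (auto intro: finite_subset[OF _ finite_adj[of x]])
    then show ?thesis unfolding common_card by linarith
  qed
  have "2 * real d - 2 \<le> (\<Sum>u\<in>?N. (2 / common x u - 2)\<^sup>2 + (common x u - 1) * (2 / common x u)\<^sup>2)"
    by (rule CD2_edge_test[OF xy tri])
  also have "\<dots> = (\<Sum>u\<in>?N. common x u - (common x u - 2)\<^sup>2 / common x u)"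
  proof (intro sum.cong refl)
    fix u assume "u \<in> ?N"
    then have c: "common x u * (1 / common x u) = 1" using pos[of u] by simp
    define r where "r = 1 / common x u"
    have "2 / common x u = 2 * r" "(common x u - 2)\<^sup>2 / common x u = (common x u - 2)\<^sup>2 * r"
      by (simp_all add: r_def)
    moreover have "(2 * r - 2)\<^sup>2 + (common x u - 1) * (2 * r)\<^sup>2 = common x u - (common x u - 2)\<^sup>2 * r"
      using c[folded r_def] by algebra
    ultimately show "(2 / common x u - 2)\<^sup>2 + (common x u - 1) * (2 / common x u)\<^sup>2
        = common x u - (common x u - 2)\<^sup>2 / common x u" by simp
  qed
  also have "\<dots> = (2 * real d - 2) - (\<Sum>u\<in>?N. (common x u - 2)\<^sup>2 / common x u)"
    using sum_common_beyond_edge[OF xy] w3 by (simp add: sum_subtractf)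
  finally have "(\<Sum>u\<in>?N. (common x u - 2)\<^sup>2 / common x u) \<le> 0" by simp
  moreover have nn: "(common x u - 2)\<^sup>2 / common x u \<ge> 0" for u
    by (simp add: common_nonneg)
  ultimately have "(\<Sum>u\<in>?N. (common x u - 2)\<^sup>2 / common x u) = 0"
    using sum_nonneg[of ?N "\<lambda>u. (common x u - 2)\<^sup>2 / common x u"] by (simp add: antisym)
  then have "(common x z - 2)\<^sup>2 / common x z = 0"
    using yz zx by (subst (asm) sum_nonneg_eq_0_iff) (auto simp: nn)
  then show ?thesis using pos[of z] yz zx by simp
qed

text \<open>
  The two harmonicity statements are added with a factor \<open>3 d\<close> on the triangles. On an edge in a
  triangle this outweighs a possible deficit of 4-cycles, and on the other edges
  \<open>walks3_lower_bound\<close> applies; so \<open>\<phi>\<close> is harmonic for symmetric nonnegative weights. By summation by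
  parts it is constant on the edges of positive weight. An edge on which it is not constant has weight
  0, which is only possible if it is triangle-free and attains the lower bound.
\<close>

lemma nonconstant_edge:
  assumes E: "\<phi> \<in> E" and xy: "adj x y" and ne: "\<phi> x \<noteq> \<phi> y"
  shows "common x y = 0" "walks3 x y = 3 * real d - 2"
proof -
  define W where "W = (\<lambda>x y. A x y * (walks3 x y - (3 * real d - 2) + 3 * real d * common x y))"
  have W_nonneg: "W u v \<ge> 0" for u v
  proof (cases "adj u v \<and> common u v \<noteq> 0")
    case True
    then have "common u v \<ge> 1" by (simp add: common_ge_1)
    then have "3 * real d * common u v \<ge> 3 * real d" by (simp add: mult_le_cancel_left1)
    then show ?thesis using walks3_nonneg[of u v] by (simp add: W_def)
  next
    case False
    then show ?thesis using walks3_lower_bound[of u v] by (auto simp: W_def A_def)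
  qed
  have W_sym: "W u v = W v u" for u v
    by (simp add: W_def A_sym walks3_sym common_sym)
  have harm: "(\<Sum>v\<in>V. W u v * (\<phi> v - \<phi> u)) = 0" if "u \<in> V" for u
  proof -
    have "(\<Sum>v\<in>V. W u v * (\<phi> v - \<phi> u))
      = (\<Sum>v\<in>V. A u v * (walks3 u v - (3 * real d - 2)) * (\<phi> v - \<phi> u))
        + 3 * real d * (\<Sum>v\<in>V. A u v * common u v * (\<phi> v - \<phi> u))"
      unfolding sum_distrib_left sum.distrib[symmetric]
      by (intro sum.cong refl) (simp add: W_def algebra_simps)
    then show ?thesis using harmonic_for_squares[OF E that] harmonic_for_triangles[OF E that] by simp
  qed
  let ?S = "\<Sum>u\<in>V. \<Sum>v\<in>V. W u v * (\<phi> v - \<phi> u) * \<phi> u"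
  have S0: "?S = 0"
    using harm by (simp flip: sum_distrib_right)
  have "?S = (\<Sum>u\<in>V. \<Sum>v\<in>V. W u v * (\<phi> u - \<phi> v) * \<phi> v)"
    by (subst sum.swap) (simp add: W_sym)
  then have "(\<Sum>u\<in>V. \<Sum>v\<in>V. W u v * (\<phi> v - \<phi> u)\<^sup>2) = - 2 * ?S"
    by (simp add: sum_negf[symmetric] sum.distrib[symmetric] power2_eq_square algebra_simps)
       (simp add: sum.distrib sum_subtractf sum_distrib_left algebra_simps)
  then have "(\<Sum>u\<in>V. \<Sum>v\<in>V. W u v * (\<phi> v - \<phi> u)\<^sup>2) = 0" using S0 by simp
  then have "W x y * (\<phi> y - \<phi> x)\<^sup>2 = 0"
    using adj_V[OF xy] W_nonneg
    by (simp add: sum_nonneg_eq_0_iff sum_nonneg)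
  then have W0: "walks3 x y - (3 * real d - 2) + 3 * real d * common x y = 0"
    using xy ne by (simp add: W_def A_def)
  have dpos: "d \<ge> 1"
  proof -
    have "y \<in> {z. adj x z}" using xy by simp
    then have "card {z. adj x z} > 0" by (simp add: card_gt_0_iff) blast
    then show ?thesis using sum_A_degree[of x] adj_V[OF xy] sum_A[of x "\<lambda>_. 1"] by simp
  qed
  show t: "common x y = 0"
  proof (rule ccontr)
    assume "common x y \<noteq> 0"
    then have "common x y \<ge> 1" by (rule common_ge_1)
    then have "3 * real d * common x y \<ge> 3 * real d" by (simp add: mult_le_cancel_left1)
    then show False using W0 walks3_nonneg[of x y] dpos by linarith
  qed
  show "walks3 x y = 3 * real d - 2" using W0 t by simp
qed

text \<open>
  By \<open>common_eq_2\<close>, with the roles of \<open>x\<close> and \<open>y\<close> exchanged, \<open>y\<close> and \<open>w\<close> have exactly two common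
  neighbours, one of which is \<open>x\<close>. The balance identity for \<open>y\<close> and \<open>w\<close> then has only two summands
  and becomes the parallelogram law.
\<close>

lemma rigid_square:
  assumes E: "\<phi> \<in> E" and xy: "adj x y" and ne: "\<phi> x \<noteq> \<phi> y" and xw: "adj x w" and wy: "w \<noteq> y"
  obtains z where "z \<noteq> x" "{u. adj y u \<and> adj w u} = {x, z}"
    "\<And>\<psi>. \<psi> \<in> E \<Longrightarrow> \<psi> x + \<psi> z = \<psi> y + \<psi> w"
proof -
  have yx: "adj y x" using xy adj_sym by blast
  have "common y w = 2"
    using common_eq_2[OF yx nonconstant_edge[OF E yx] xw wy] ne by auto
  then have "real (card {u. adj y u \<and> adj u w}) = 2" unfolding common_card .
  moreover have "{u. adj y u \<and> adj u w} = {u. adj y u \<and> adj w u}"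
    using adj_sym by blast
  ultimately have "card {u. adj y u \<and> adj w u} = 2" by simp
  moreover have "x \<in> {u. adj y u \<and> adj w u}"
    using yx xw adj_sym by auto
  ultimately obtain z where z: "z \<noteq> x" "{u. adj y u \<and> adj w u} = {x, z}"
  proof (elim card_2_iff[THEN iffD1, elim_format] exE conjE)
    fix p q assume "{u. adj y u \<and> adj w u} = {p, q}" "p \<noteq> q" "x \<in> {u. adj y u \<and> adj w u}"
    then show thesis using that[of p] that[of q] by (cases "x = p") (auto simp: insert_commute)
  qed
  have "\<psi> x + \<psi> z = \<psi> y + \<psi> w" if "\<psi> \<in> E" for \<psi>
  proof -
    have "0 = (\<Sum>u\<in>V. A y u * A u w * (\<psi> y + \<psi> w - 2 * \<psi> u))"
      using common_neighbours_balanced[OF that, of y w] adj_V xy xw wy by auto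
    also have "\<dots> = (\<Sum>u\<in>{x, z}. \<psi> y + \<psi> w - 2 * \<psi> u)"
      unfolding z(2)[symmetric] by (rule sum.mono_neutral_cong_right) (auto simp: A_def dest: adj_V adj_sym)
    also have "\<dots> = 2 * (\<psi> y + \<psi> w) - 2 * \<psi> x - 2 * \<psi> z"
      using z(1) by simp
    finally show ?thesis by simp
  qed
  then show ?thesis using that z by blast
qed

end

section \<open>The least nonzero eigenvalue\<close>

lemma sum_fun_apply: "(\<Sum>i\<in>I. f i) x = (\<Sum>i\<in>I. f i x :: real)"
  by (induction I rule: infinite_finite_induct) auto

lemma mult_self_pos: "r \<noteq> 0 \<Longrightarrow> r * r > (0 :: real)"
  using not_real_square_gt_zero[of r] by blast

definition unit_fun :: "'a \<Rightarrow> 'a \<Rightarrow> real" where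
  "unit_fun v u = (if u = v then 1 else 0)"

lemma supported_in_span:
  assumes "finite S" "\<And>x. x \<notin> S \<Longrightarrow> f x = 0"
  shows "f \<in> fun_space.span (unit_fun ` S)"
proof -
  have "f = (\<Sum>v\<in>S. (\<lambda>u. f v * unit_fun v u))"
  proof
    fix x
    have "(\<Sum>v\<in>S. f v * unit_fun v x) = (\<Sum>v\<in>S. if v = x then f x else 0)"
      by (intro sum.cong refl) (simp add: unit_fun_def)
    then show "f x = (\<Sum>v\<in>S. (\<lambda>u. f v * unit_fun v u)) x"
      using assms by (simp add: sum_fun_apply)
  qed
  moreover have "(\<Sum>v\<in>S. (\<lambda>u. f v * unit_fun v u)) \<in> fun_space.span (unit_fun ` S)"
    by (intro fun_space.span_sum fun_space.span_scale fun_space.span_base imageI)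
  ultimately show ?thesis by simp
qed

lemma orthogonal_independent:
  assumes fin: "finite B"
    and orth: "\<And>f g. f \<in> B \<Longrightarrow> g \<in> B \<Longrightarrow> f \<noteq> g \<Longrightarrow> (\<Sum>x\<in>S. f x * g x) = (0 :: real)"
    and nz: "\<And>f. f \<in> B \<Longrightarrow> (\<Sum>x\<in>S. f x * f x) \<noteq> 0"
  shows "fun_space.independent B"
  unfolding fun_space.dependent_finite[OF fin]
proof (intro notI, elim exE conjE bexE)
  fix u g assume g: "g \<in> B" "u g \<noteq> 0" and eq: "(\<Sum>f\<in>B. (\<lambda>x. u f * f x)) = 0"
  have "0 = (\<Sum>x\<in>S. (\<Sum>f\<in>B. (\<lambda>x. u f * f x)) x * g x)"
    unfolding eq by simp
  also have "\<dots> = (\<Sum>f\<in>B. u f * (\<Sum>x\<in>S. f x * g x))"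
    unfolding sum_fun_apply sum_distrib_right sum_distrib_left
    by (subst sum.swap) (simp add: mult.assoc)
  also have "\<dots> = (\<Sum>f\<in>B. if f = g then u g * (\<Sum>x\<in>S. g x * g x) else 0)"
    by (intro sum.cong refl) (use g orth in auto)
  also have "\<dots> = u g * (\<Sum>x\<in>S. g x * g x)"
    using g fin by simp
  finally show False using g nz[of g] by simp
qed

context connected_pair_graph
begin

lemma eigenspace_in_span: "eigenspace G \<mu> \<subseteq> fun_space.span (unit_fun ` V)"
  using supported_in_span[OF finite_V] eigenspaceD(2) by blast

lemma eigenspace_orthogonal:
  assumes f: "f \<in> eigenspace G \<mu>" and g: "g \<in> eigenspace G \<nu>" and ne: "\<mu> \<noteq> \<nu>"
  shows "(\<Sum>x\<in>V. f x * g x) = 0"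
proof -
  have "(\<Sum>x\<in>V. g x * Laplacian G f x) = (\<Sum>x\<in>V. f x * Laplacian G g x)"
    unfolding sum_Laplacian by (simp add: mult.commute)
  then have "- \<mu> * (\<Sum>x\<in>V. f x * g x) = - \<nu> * (\<Sum>x\<in>V. f x * g x)"
    unfolding eigenspaceD(1)[OF f] eigenspaceD(1)[OF g] sum_distrib_left by (simp add: mult_ac)
  then show ?thesis using ne by simp
qed

lemma eigenfunction_norm:
  assumes f: "f \<in> eigenspace G \<mu>" and "f \<noteq> 0"
  shows "(\<Sum>x\<in>V. f x * f x) > 0"
proof -
  obtain x where x: "f x \<noteq> 0" using \<open>f \<noteq> 0\<close> by (auto simp: fun_eq_iff)
  then have "x \<in> V" using eigenspaceD(2)[OF f] by blast
  moreover have "f x * f x > 0" by (rule mult_self_pos[OF x])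
  ultimately show ?thesis by (intro sum_pos2[of V x]) simp_all
qed

lemma Dirichlet_form_0_imp_constant:
  assumes "(\<Sum>x\<in>V. \<Sum>y\<in>V. A x y * ((f y - f x) * (f y - f x))) = 0" "x \<in> V" "y \<in> V"
  shows "f x = f y"
proof (rule constant_on_edges)
  fix u v assume uv: "adj u v"
  have "A u v * ((f v - f u) * (f v - f u)) = 0"
    using assms(1) adj_V[OF uv] by (simp add: sum_nonneg_eq_0_iff sum_nonneg)
  then show "f u = f v" using uv by (simp add: A_def)
qed (use assms in simp_all)

lemma Dirichlet_form_eigen:
  assumes f: "f \<in> eigenspace G \<mu>"
  shows "(\<Sum>x\<in>V. \<Sum>y\<in>V. A x y * ((f y - f x) * (f y - f x))) = 2 * \<mu> * (\<Sum>x\<in>V. f x * f x)"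
  using sum_Laplacian[of f f] unfolding eigenspaceD(1)[OF f]
  by (simp add: sum_negf sum_distrib_left mult_ac)

lemma eigenvalue_nonneg:
  assumes "\<mu> \<in> eigenvalues G"
  shows "\<mu> \<ge> 0"
proof -
  obtain f where f: "f \<in> eigenspace G \<mu>" "f \<noteq> 0" using assms by (auto simp: eigenvalues_def)
  have "0 \<le> 2 * \<mu> * (\<Sum>x\<in>V. f x * f x)"
    unfolding Dirichlet_form_eigen[OF f(1), symmetric] by (intro sum_nonneg) simp
  then show ?thesis using eigenfunction_norm[OF f] by (simp add: zero_le_mult_iff)
qed

lemma eigenspace_0:
  "eigenspace G 0 = {\<lambda>x. if x \<in> V then c else (0::real) | c. True}"
proof (intro equalityI subsetI)
  fix f assume f: "f \<in> eigenspace G 0"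
  obtain x0 where x0: "x0 \<in> V" using V_nonempty by blast
  have "f x = f x0" if "x \<in> V" for x
    by (rule Dirichlet_form_0_imp_constant) (use Dirichlet_form_eigen[OF f] that x0 in simp_all)
  then have "f = (\<lambda>x. if x \<in> V then f x0 else 0)" using eigenspaceD(2)[OF f] by fastforce
  then show "f \<in> {\<lambda>x. if x \<in> V then c else (0::real) | c. True}" by blast
next
  fix f assume "f \<in> {\<lambda>x. if x \<in> V then c else (0::real) | c. True}"
  then obtain c where "f = (\<lambda>x. if x \<in> V then c else 0)" by blast
  then show "f \<in> eigenspace G 0"
    by (auto simp: eigenspace_def Laplacian_eq intro!: sum.neutral)
qed

lemma zero_eigenvalue: "0 \<in> eigenvalues G"
proof -
  have "(\<lambda>x. if x \<in> V then 1 else 0 :: real) \<in> eigenspace G 0"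
    unfolding eigenspace_0 by blast
  moreover have "(\<lambda>x. if x \<in> V then 1 else 0 :: real) \<noteq> 0"
    using V_nonempty by (auto simp: fun_eq_iff)
  ultimately show ?thesis unfolding eigenvalues_def by blast
qed

text \<open>
  Eigenfunctions to different eigenvalues are orthogonal, so there are at most as many eigenvalues
  as vertices.
\<close>

lemma finite_eigenvalues: "finite (eigenvalues G)"
proof (rule ccontr)
  assume "infinite (eigenvalues G)"
  then obtain F where F: "F \<subseteq> eigenvalues G" "finite F" "card F = Suc (card V)"
    using infinite_arbitrarily_large by blast
  have "\<forall>\<mu>\<in>F. \<exists>f. f \<in> eigenspace G \<mu> \<and> f \<noteq> 0"
    using F(1) by (auto simp: eigenvalues_def)
  then obtain f where f: "\<And>\<mu>. \<mu> \<in> F \<Longrightarrow> f \<mu> \<in> eigenspace G \<mu>" "\<And>\<mu>. \<mu> \<in> F \<Longrightarrow> f \<mu> \<noteq> 0"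
    by metis
  have orth: "(\<Sum>x\<in>V. f \<mu> x * f \<nu> x) = 0" if "\<mu> \<in> F" "\<nu> \<in> F" "\<mu> \<noteq> \<nu>" for \<mu> \<nu>
    by (rule eigenspace_orthogonal[OF f(1)[OF that(1)] f(1)[OF that(2)] that(3)])
  have pos: "(\<Sum>x\<in>V. f \<mu> x * f \<mu> x) > 0" if "\<mu> \<in> F" for \<mu>
    by (rule eigenfunction_norm[OF f(1)[OF that] f(2)[OF that]])
  have inj: "inj_on f F"
  proof (rule inj_onI, rule ccontr)
    fix \<mu> \<nu> assume a: "\<mu> \<in> F" "\<nu> \<in> F" "f \<mu> = f \<nu>" "\<mu> \<noteq> \<nu>"
    show False using orth[OF a(1,2,4)] pos[OF a(1)] unfolding a(3) by simp
  qed
  have "fun_space.independent (f ` F)"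
  proof (rule orthogonal_independent[of _ V])
    show "finite (f ` F)" using F(2) by simp
    show "(\<Sum>x\<in>V. p x * q x) = 0" if pq: "p \<in> f ` F" "q \<in> f ` F" "p \<noteq> q" for p q
    proof -
      obtain \<mu> \<nu> where "\<mu> \<in> F" "p = f \<mu>" "\<nu> \<in> F" "q = f \<nu>" using pq by blast
      then show ?thesis using orth[of \<mu> \<nu>] pq(3) by auto
    qed
    show "(\<Sum>x\<in>V. p x * p x) \<noteq> 0" if "p \<in> f ` F" for p
      using that pos by fastforce
  qed
  moreover have "f ` F \<subseteq> fun_space.span (unit_fun ` V)"
    using f(1) eigenspace_in_span by blast
  ultimately have "card (f ` F) \<le> card (unit_fun ` V)"
    using fun_space.independent_span_bound[of "unit_fun ` V" "f ` F"] by simp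
  then show False
    using card_image[OF inj] F(3) card_image_le[OF finite_V, of unit_fun] by simp
qed

lemma eigenvalue_mult_pos:
  assumes "\<mu> \<in> eigenvalues G"
  shows "eigenvalue_mult G \<mu> \<ge> 1"
proof -
  obtain f where f: "f \<in> eigenspace G \<mu>" "f \<noteq> 0" using assms by (auto simp: eigenvalues_def)
  obtain B where B: "B \<subseteq> eigenspace G \<mu>" "fun_space.independent B" "eigenspace G \<mu> \<subseteq> fun_space.span B"
    "card B = fun_space.dim (eigenspace G \<mu>)"
    using fun_space.basis_exists[of "eigenspace G \<mu>"] by metis
  have "finite B"
    using fun_space.independent_span_bound[of "unit_fun ` V" B] B(1,2) eigenspace_in_span by fastforce
  moreover have "B \<noteq> {}" using B(3) f by auto
  ultimately have "card B > 0" by (simp add: card_gt_0_iff)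
  then show ?thesis unfolding eigenvalue_mult_def B(4)[symmetric] by simp
qed

lemma eigenvalue_mult_0: "eigenvalue_mult G 0 = 1"
proof -
  let ?one = "\<lambda>x. if x \<in> V then 1 else 0 :: real"
  have "eigenspace G 0 \<subseteq> fun_space.span {?one}"
  proof
    fix f assume "f \<in> eigenspace G 0"
    then obtain c where "f = (\<lambda>x. if x \<in> V then c else 0)" unfolding eigenspace_0 by blast
    then have "f = (\<lambda>x. c * ?one x)" by auto
    then show "f \<in> fun_space.span {?one}"
      using fun_space.span_scale[OF fun_space.span_base[of ?one "{?one}"], of c] by simp
  qed
  then have "fun_space.dim (eigenspace G 0) \<le> card {?one}"
    by (rule fun_space.dim_le_card) simp
  then show ?thesis
    using eigenvalue_mult_pos[OF zero_eigenvalue] by (simp add: eigenvalue_mult_def)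
qed

text \<open>
  A function minimising the Rayleigh quotient \<open>Q / N\<close> among the nonzero functions of mean zero is an
  eigenfunction. The minimum exists because the functions on the vertices of norm 1 and mean zero form
  a closed subset of a cube, which is compact in the product topology. Its eigenvalue is
  not 0, as a mean-zero function with vanishing Dirichlet form is zero on a connected graph.
\<close>

lemma exists_nonzero_eigenvalue:
  assumes card: "card V > 1"
  shows "\<exists>\<mu>\<in>eigenvalues G. \<mu> \<noteq> 0"
proof -
  define Q where "Q = (\<lambda>f :: 'a \<Rightarrow> real. \<Sum>x\<in>V. \<Sum>y\<in>V. A x y * ((f y - f x) * (f y - f x)))"
  define N where "N = (\<lambda>f :: 'a \<Rightarrow> real. \<Sum>x\<in>V. f x * f x)"
  define W where "W = {f :: 'a \<Rightarrow> real. (\<Sum>x\<in>V. f x) = 0 \<and> (\<forall>x. x \<notin> V \<longrightarrow> f x = 0)}"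
  define C where "C = PiE UNIV (\<lambda>x. if x \<in> V then {-1..1} else {0 :: real})"
  define S where "S = C \<inter> {f. (\<Sum>x\<in>V. f x) = 0} \<inter> {f. N f = 1}"
  have coord: "continuous_on T (\<lambda>f :: 'a \<Rightarrow> real. f x)" for T x
    by (rule continuous_on_subset[OF continuous_on_product_coordinates]) simp
  have "compactin (product_topology (\<lambda>_. euclidean) UNIV) C"
    unfolding C_def compactin_PiE by simp
  then have "compact C"
    by (simp add: euclidean_product_topology)
  moreover have "closed {f :: 'a \<Rightarrow> real. (\<Sum>x\<in>V. f x) = 0}"
    by (intro closed_Collect_eq continuous_on_sum coord continuous_on_const)
  moreover have "closed {f :: 'a \<Rightarrow> real. N f = 1}"
    unfolding N_def by (intro closed_Collect_eq continuous_on_sum continuous_on_mult coord continuous_on_const)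
  ultimately have compact: "compact S"
    unfolding S_def by (intro compact_Int_closed)
  have SI: "f \<in> S" if "f \<in> W" "N f = 1" for f
  proof -
    have "f x \<in> (if x \<in> V then {-1..1} else {0})" for x
    proof (cases "x \<in> V")
      case True
      have "f x * f x \<le> N f"
        unfolding N_def by (rule member_le_sum[OF True]) auto
      then have "\<bar>f x\<bar> \<le> 1" using that(2) by (simp add: abs_le_square_iff[of _ 1, simplified] power2_eq_square)
      then show ?thesis using True by auto
    qed (use that in \<open>simp add: W_def\<close>)
    then show ?thesis using that by (auto simp: S_def C_def W_def)
  qed
  have SD: "f \<in> W" "N f = 1" if "f \<in> S" for f
  proof -
    have "f x \<in> (if x \<in> V then {-1..1} else {0})" for x
      using that by (auto simp: S_def C_def PiE_def Pi_def)
    then have "f x = 0" if "x \<notin> V" for x using that by (metis singletonD)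
    then show "f \<in> W" "N f = 1" using that by (auto simp: S_def W_def)
  qed
  have scale: "(\<lambda>x. c * f x) \<in> W" "N (\<lambda>x. c * f x) = c\<^sup>2 * N f" "Q (\<lambda>x. c * f x) = c\<^sup>2 * Q f" if "f \<in> W" for c f
    using that by (auto simp: W_def N_def Q_def sum_distrib_left[symmetric] power2_eq_square)
      (simp_all add: sum_distrib_left algebra_simps)
  have N_pos: "N f > 0" if "f \<in> W" "f \<noteq> 0" for f
  proof -
    obtain x where x: "f x \<noteq> 0" using \<open>f \<noteq> 0\<close> by (auto simp: fun_eq_iff)
    then have "f x * f x > 0" by (rule mult_self_pos)
    moreover have "x \<in> V" using \<open>f \<in> W\<close> \<open>f x \<noteq> 0\<close> unfolding W_def by blast
    ultimately show ?thesis unfolding N_def by (intro sum_pos2[of V x]) simp_all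
  qed
  have normalise: "(\<lambda>x. (1 / sqrt (N f)) * f x) \<in> S" if "f \<in> W" "f \<noteq> 0" for f
    using scale[OF that(1), of "1 / sqrt (N f)"] N_pos[OF that] by (intro SI) (simp_all add: power_divide)
  have "\<exists>f\<in>W. f \<noteq> 0"
  proof -
    obtain p q where pq: "p \<in> V" "q \<in> V" "p \<noteq> q"
      using card by (metis One_nat_def card_le_Suc0_iff_eq finite_V not_le)
    let ?f = "\<lambda>x. unit_fun p x - unit_fun q x"
    have "?f \<in> W" using pq by (auto simp: W_def unit_fun_def sum_subtractf)
    moreover have "?f p \<noteq> 0" using pq by (simp add: unit_fun_def)
    ultimately show ?thesis by (intro bexI[of _ ?f]) (auto simp: fun_eq_iff)
  qed
  then have "S \<noteq> {}" using normalise by blast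
  moreover have "continuous_on S Q"
    unfolding Q_def by (intro continuous_on_sum continuous_on_mult continuous_on_diff coord continuous_on_const)
  ultimately obtain g where g: "g \<in> S" "\<And>f. f \<in> S \<Longrightarrow> Q g \<le> Q f"
    using continuous_attains_inf[OF compact] by blast
  note gW = SD[OF g(1)]
  have min: "Q g * N f \<le> Q f" if f: "f \<in> W" for f
  proof (cases "f = 0")
    case False
    have "Q g \<le> Q (\<lambda>x. (1 / sqrt (N f)) * f x)" by (rule g(2)[OF normalise[OF f False]])
    also have "\<dots> = Q f / N f" unfolding scale(3)[OF f] using N_pos[OF f False] by (simp add: power_divide)
    finally show ?thesis using N_pos[OF f False] by (simp add: field_simps)
  qed (simp add: N_def Q_def)
  \<comment> \<open>Up to a factor, \<open>u\<close> is the gradient of \<open>Q - Q g \<cdot> N\<close> at the minimiser \<open>g\<close>; it has mean zero, so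
      varying \<open>g\<close> in the direction of \<open>u\<close> itself is allowed and yields \<open>N u = 0\<close>. Since \<open>Q\<close> counts
      every edge twice, the eigenvalue is \<open>Q g / 2\<close>.\<close>
  define u where "u = (\<lambda>x. Laplacian G g x + Q g / 2 * g x)"
  have uW: "u \<in> W"
  proof -
    have "(\<Sum>x\<in>V. u x) = (\<Sum>x\<in>V. Laplacian G g x) + Q g / 2 * (\<Sum>x\<in>V. g x)"
      unfolding u_def sum.distrib sum_distrib_left ..
    then show ?thesis
      using gW(1) by (simp add: W_def u_def sum_Laplacian_0 Laplacian_outside)
  qed
  define B where "B = (\<Sum>x\<in>V. \<Sum>y\<in>V. A x y * ((g y - g x) * (u y - u x))) - Q g * (\<Sum>x\<in>V. g x * u x)"
  have "0 \<le> s * (2 * B) + s\<^sup>2 * (Q u - Q g * N u)" for s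
  proof -
    have "(\<lambda>x. g x + s * u x) \<in> W"
      using gW(1) uW by (auto simp: W_def sum.distrib simp flip: sum_distrib_left)
    from min[OF this] have "0 \<le> Q (\<lambda>x. g x + s * u x) - Q g * N (\<lambda>x. g x + s * u x)" by simp
    also have "Q (\<lambda>x. g x + s * u x) = Q g + 2 * s * (\<Sum>x\<in>V. \<Sum>y\<in>V. A x y * ((g y - g x) * (u y - u x))) + s\<^sup>2 * Q u"
      unfolding Q_def sum_distrib_left sum.distrib[symmetric]
      by (intro sum.cong refl) (simp add: algebra_simps power2_eq_square)
    also have "N (\<lambda>x. g x + s * u x) = N g + 2 * s * (\<Sum>x\<in>V. g x * u x) + s\<^sup>2 * N u"
      unfolding N_def sum_distrib_left sum.distrib[symmetric]
      by (intro sum.cong refl) (simp add: algebra_simps power2_eq_square)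
    finally show ?thesis by (simp add: B_def gW(2) algebra_simps)
  qed
  then have "2 * B = 0" by (rule nonneg_quadratic_imp_linear_0)
  then have "(\<Sum>x\<in>V. \<Sum>y\<in>V. A x y * ((g y - g x) * (u y - u x))) = Q g * (\<Sum>x\<in>V. g x * u x)"
    by (simp add: B_def)
  then have "2 * (\<Sum>x\<in>V. u x * Laplacian G g x) + Q g * (\<Sum>x\<in>V. g x * u x) = 0"
    unfolding sum_Laplacian by simp
  moreover have "2 * N u = 2 * (\<Sum>x\<in>V. u x * Laplacian G g x) + Q g * (\<Sum>x\<in>V. g x * u x)"
    unfolding N_def sum_distrib_left sum.distrib[symmetric]
    by (intro sum.cong refl) (simp add: u_def algebra_simps)
  ultimately have "N u = 0" by simp
  then have "u = 0" using N_pos[OF uW] by fastforce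
  have g_eig: "g \<in> eigenspace G (Q g / 2)"
  proof -
    have "u x = 0" for x using \<open>u = 0\<close> by simp
    then have "Laplacian G g x = - (Q g / 2 * g x)" for x
      unfolding u_def by (simp add: eq_neg_iff_add_eq_0)
    then show ?thesis using gW(1) by (simp add: eigenspace_def W_def)
  qed
  have g0: "g \<noteq> 0" using gW(2) by (auto simp: N_def)
  have "Q g \<noteq> 0"
  proof
    assume "Q g = 0"
    obtain x0 where x0: "x0 \<in> V" using V_nonempty by blast
    have c: "g x = g x0" if "x \<in> V" for x
      by (rule Dirichlet_form_0_imp_constant) (use \<open>Q g = 0\<close> that x0 in \<open>simp_all add: Q_def\<close>)
    then have "(\<Sum>x\<in>V. g x) = card V * g x0" by simp
    then have "g x0 = 0" using gW(1) V_nonempty by (simp add: W_def)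
    then have "N g = 0" using c by (simp add: N_def)
    then show False using gW(2) by simp
  qed
  then show ?thesis
    using g_eig g0 by (intro bexI[of _ "Q g / 2"]) (auto simp: eigenvalues_def)
qed

text \<open>
  The sorted spectrum starts with the eigenvalue 0. It occurs only once, because connectedness makes
  the eigenspace of 0 one-dimensional, so the next entry is the least nonzero eigenvalue.
\<close>

theorem lambda1_least:
  assumes card: "card V > 1"
  shows "lambda1 G \<in> eigenvalues G" "lambda1 G \<noteq> 0"
    "\<And>\<mu>. \<mu> \<in> eigenvalues G \<Longrightarrow> \<mu> \<noteq> 0 \<Longrightarrow> lambda1 G \<le> \<mu>"
proof -
  define M where "M = (\<Sum>\<mu>\<in>eigenvalues G. replicate_mset (eigenvalue_mult G \<mu>) \<mu>)"
  define xs where "xs = spectrum_list G"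
  have xs: "mset xs = M" "sorted xs"
    by (simp_all add: xs_def spectrum_list_def M_def)
  have "count M \<nu> = (\<Sum>\<mu>\<in>eigenvalues G. if \<mu> = \<nu> then eigenvalue_mult G \<nu> else 0)" for \<nu>
    unfolding M_def count_sum by (intro sum.cong refl) simp
  then have cnt: "count M \<nu> = (if \<nu> \<in> eigenvalues G then eigenvalue_mult G \<nu> else 0)" for \<nu>
    using finite_eigenvalues by simp
  have set_xs: "set xs = eigenvalues G"
  proof (rule set_eqI)
    fix \<nu>
    have "\<nu> \<in> set xs \<longleftrightarrow> count M \<nu> > 0"
      unfolding xs(1)[symmetric] count_greater_zero_iff set_mset_mset ..
    also have "\<dots> \<longleftrightarrow> \<nu> \<in> eigenvalues G"
      using eigenvalue_mult_pos[of \<nu>] by (cases "\<nu> \<in> eigenvalues G") (simp_all add: cnt)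
    finally show "\<nu> \<in> set xs \<longleftrightarrow> \<nu> \<in> eigenvalues G" .
  qed
  obtain \<nu> where \<nu>: "\<nu> \<in> eigenvalues G" "\<nu> \<noteq> 0" using exists_nonzero_eigenvalue[OF card] by blast
  obtain x0 ys where ys: "xs = x0 # ys"
    using \<nu>(1) set_xs by (cases xs) auto
  have x0: "x0 = 0"
  proof -
    have "0 \<in> set xs" unfolding set_xs by (rule zero_eigenvalue)
    then have "x0 \<le> 0" using xs(2) unfolding ys by auto
    moreover have "x0 \<ge> 0" by (rule eigenvalue_nonneg) (use set_xs ys in auto)
    ultimately show ?thesis by simp
  qed
  have "count (mset xs) 0 = 1"
    unfolding xs(1) cnt using zero_eigenvalue eigenvalue_mult_0 by simp
  then have "count (mset ys) 0 = 0" unfolding ys x0 by simp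
  then have no0: "0 \<notin> set ys" unfolding count_eq_zero_iff set_mset_mset .
  have "\<nu> \<in> set ys" using \<nu> set_xs unfolding ys x0 by auto
  then obtain x1 zs where zs: "ys = x1 # zs" by (cases ys) auto
  have l: "lambda1 G = x1" by (simp add: lambda1_def xs_def[symmetric] ys zs)
  show "lambda1 G \<in> eigenvalues G" unfolding l set_xs[symmetric] ys zs by simp
  show "lambda1 G \<noteq> 0" unfolding l using no0 zs by auto
  show "lambda1 G \<le> \<mu>" if "\<mu> \<in> eigenvalues G" "\<mu> \<noteq> 0" for \<mu>
    using that xs(2) unfolding l set_xs[symmetric] ys x0 zs by auto
qed

section \<open>Generic eigenfunctions\<close>

lemma eigenspaceI:
  assumes "\<And>x. x \<in> V \<Longrightarrow> - Laplacian G f x = \<mu> * f x" "\<And>x. x \<notin> V \<Longrightarrow> f x = 0"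
  shows "f \<in> eigenspace G \<mu>"
  unfolding eigenspace_def using assms by blast

lemma eigenspace_add_scaled:
  assumes f: "f \<in> eigenspace G \<mu>" and g: "g \<in> eigenspace G \<mu>"
  shows "(\<lambda>u. f u + s * g u) \<in> eigenspace G \<mu>"
proof (rule eigenspaceI)
  fix x
  show "- Laplacian G (\<lambda>u. f u + s * g u) x = \<mu> * (f x + s * g x)"
    unfolding Laplacian_add_scaled eigenspaceD(1)[OF f] eigenspaceD(1)[OF g] by (simp add: algebra_simps)
next
  fix x assume "x \<notin> V"
  then show "f x + s * g x = 0" using eigenspaceD(2)[OF f] eigenspaceD(2)[OF g] by simp
qed

lemma eigenspace_zero: "(\<lambda>_. 0) \<in> eigenspace G \<mu>"
  by (rule eigenspaceI) (simp_all add: Laplacian_eq)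

text \<open>
  For each pair separated by some eigenfunction, the eigenfunctions that do not separate it form a
  proper subspace, and finitely many proper subspaces do not cover a real vector space. In the
  induction, a new pair separated by \<open>\<psi>\<close> but not by \<open>h\<close> is handled by passing to \<open>h + s \<psi>\<close>, where
  \<open>s\<close> avoids 0 and the finitely many values that would identify an old pair.
\<close>

lemma generic_eigenfunction_on:
  assumes "finite F"
  shows "\<exists>h\<in>eigenspace G \<mu>. \<forall>x y. (x, y) \<in> F \<longrightarrow> h x = h y \<longrightarrow> (\<forall>\<psi>\<in>eigenspace G \<mu>. \<psi> x = \<psi> y)"
  using assms
proof (induction F)
  case empty
  then show ?case using eigenspace_zero by blast
next
  case (insert e F)
  obtain x y where e: "e = (x, y)" by (cases e)
  obtain h where h: "h \<in> eigenspace G \<mu>"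
    and "\<forall>x y. (x, y) \<in> F \<longrightarrow> h x = h y \<longrightarrow> (\<forall>\<psi>\<in>eigenspace G \<mu>. \<psi> x = \<psi> y)"
    using insert.IH by (elim bexE)
  then have hF: "\<psi> u = \<psi> v" if "(u, v) \<in> F" "\<psi> \<in> eigenspace G \<mu>" "h u = h v" for u v \<psi>
    using that by simp
  show ?case
  proof (cases "\<forall>\<psi>\<in>eigenspace G \<mu>. h x = h y \<longrightarrow> \<psi> x = \<psi> y")
    case True
    show ?thesis
    proof (rule bexI[OF _ h], intro allI impI ballI)
      fix u v \<psi> assume uv: "(u, v) \<in> insert e F" and eq: "h u = h v" and \<psi>: "\<psi> \<in> eigenspace G \<mu>"
      show "\<psi> u = \<psi> v"
      proof (cases "(u, v) \<in> F")
        case True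
        then show ?thesis using \<psi> eq by (rule hF)
      next
        case False
        with uv have "u = x" "v = y" by (simp_all add: e)
        with eq bspec[OF \<open>\<forall>\<psi>\<in>eigenspace G \<mu>. h x = h y \<longrightarrow> \<psi> x = \<psi> y\<close> \<psi>] show ?thesis by simp
      qed
    qed
  next
    case False
    then obtain \<psi> where \<psi>: "\<psi> \<in> eigenspace G \<mu>" "h x = h y" "\<psi> x \<noteq> \<psi> y" by blast
    define B where "B = insert 0 ((\<lambda>(u, v). - (h u - h v) / (\<psi> u - \<psi> v)) ` F)"
    have "finite B" using insert.hyps by (simp add: B_def)
    then obtain s where s: "s \<notin> B" using ex_new_if_finite[OF infinite_UNIV_char_0] by blast
    define h' where "h' = (\<lambda>u. h u + s * \<psi> u)"
    have h': "h' \<in> eigenspace G \<mu>" unfolding h'_def by (rule eigenspace_add_scaled[OF h \<psi>(1)])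
    show ?thesis
    proof (rule bexI[OF _ h'], intro allI impI ballI)
      fix u v \<chi> assume uv: "(u, v) \<in> insert e F" and eq: "h' u = h' v" and \<chi>: "\<chi> \<in> eigenspace G \<mu>"
      show "\<chi> u = \<chi> v"
      proof (cases "(u, v) = e")
        case True
        then have "s * (\<psi> x - \<psi> y) = 0" using eq \<psi>(2) by (simp add: e h'_def algebra_simps)
        then show ?thesis using \<psi>(3) s by (simp add: B_def)
      next
        case False
        then have uvF: "(u, v) \<in> F" using uv by simp
        have eq': "s * (\<psi> u - \<psi> v) = - (h u - h v)" using eq by (simp add: h'_def algebra_simps)
        show ?thesis
        proof (cases "\<psi> u = \<psi> v")
          case True
          then have "h u = h v" using eq' by simp
          then show ?thesis by (rule hF[OF uvF \<chi>])
        next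
          case False
          then have "s = - (h u - h v) / (\<psi> u - \<psi> v)"
            using eq' by (simp add: eq_divide_eq)
          then have "s = (\<lambda>(u, v). - (h u - h v) / (\<psi> u - \<psi> v)) (u, v)" by simp
          then have "s \<in> B" unfolding B_def by (rule insertI2[OF image_eqI]) (rule uvF)
          with s show ?thesis by (rule notE)
        qed
      qed
    qed
  qed
qed

lemma generic_eigenfunction:
  obtains h where "h \<in> eigenspace G \<mu>"
    "\<And>\<psi> x y. \<psi> \<in> eigenspace G \<mu> \<Longrightarrow> adj x y \<Longrightarrow> h x = h y \<Longrightarrow> \<psi> x = \<psi> y"
proof -
  have "\<exists>h\<in>eigenspace G \<mu>. \<forall>x y. (x, y) \<in> V \<times> V \<longrightarrow> h x = h y \<longrightarrow> (\<forall>\<psi>\<in>eigenspace G \<mu>. \<psi> x = \<psi> y)"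
    by (rule generic_eigenfunction_on) simp
  then obtain h where h: "h \<in> eigenspace G \<mu>"
      "\<forall>x y. (x, y) \<in> V \<times> V \<longrightarrow> h x = h y \<longrightarrow> (\<forall>\<psi>\<in>eigenspace G \<mu>. \<psi> x = \<psi> y)"
    by (elim bexE)
  show thesis
  proof (rule that[OF h(1)])
    fix \<psi> x y assume "\<psi> \<in> eigenspace G \<mu>" "adj x y" "h x = h y"
    then show "\<psi> x = \<psi> y" using h(2) adj_V[of x y] by simp
  qed
qed

end

section \<open>Diamonds and summits\<close>

text \<open>
  Henceforth \<open>h\<close> serves as a height function. By genericity, the edges on which \<open>h\<close> is constant are
  exactly those on which every eigenfunction to the eigenvalue 2 is constant, and rigidity is available
  for all other edges.
\<close>

locale height_graph = regular_CD2_graph +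
  fixes h :: "'a \<Rightarrow> real"
  assumes h_eig: "h \<in> E"
    and h_generic: "\<And>\<psi> x y. \<psi> \<in> E \<Longrightarrow> adj x y \<Longrightarrow> h x = h y \<Longrightarrow> \<psi> x = \<psi> y"
begin

definition up :: "'a \<Rightarrow> 'a \<Rightarrow> bool" where
  "up x y \<longleftrightarrow> adj x y \<and> h x < h y"

definition flat :: "'a \<Rightarrow> 'a \<Rightarrow> bool" where
  "flat x y \<longleftrightarrow> adj x y \<and> h x = h y"

definition summit :: "'a \<Rightarrow> bool" where
  "summit t \<longleftrightarrow> t \<in> V \<and> (\<forall>y. \<not> up t y)"

lemma flat_sym: "flat x y \<Longrightarrow> flat y x"
  unfolding flat_def by (auto intro: adj_sym)

lemma up_adj: "up x y \<Longrightarrow> adj x y" "up x y \<Longrightarrow> adj y x" "up x y \<Longrightarrow> h x < h y"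
  unfolding up_def by (auto intro: adj_sym)

lemma flat_adj: "flat x y \<Longrightarrow> adj x y" "flat x y \<Longrightarrow> adj y x" "flat x y \<Longrightarrow> h x = h y"
  unfolding flat_def by (auto intro: adj_sym)

lemma adj_cases: "adj x y \<longleftrightarrow> up x y \<or> up y x \<or> flat x y"
proof
  assume "adj x y"
  then show "up x y \<or> up y x \<or> flat x y"
    using adj_sym[of x y] unfolding up_def flat_def by linarith
next
  assume "up x y \<or> up y x \<or> flat x y"
  then show "adj x y" using up_adj(1)[of x y] up_adj(2)[of y x] flat_adj(1)[of x y] by argo
qed

lemma up_V: "up x y \<Longrightarrow> x \<in> V" "up x y \<Longrightarrow> y \<in> V"
  unfolding up_def using adj_V by auto

lemma flat_V: "flat x y \<Longrightarrow> x \<in> V" "flat x y \<Longrightarrow> y \<in> V"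
  unfolding flat_def using adj_V by auto

lemma square:
  assumes "adj x y" "h x \<noteq> h y" "adj x w" "w \<noteq> y"
  obtains z where "z \<noteq> x" "adj y z" "adj w z" "\<And>\<psi>. \<psi> \<in> E \<Longrightarrow> \<psi> x + \<psi> z = \<psi> y + \<psi> w"
    "\<And>u. adj y u \<Longrightarrow> adj w u \<Longrightarrow> u = x \<or> u = z"
proof (rule rigid_square[OF h_eig assms])
  fix z assume z: "z \<noteq> x" and c: "{u. adj y u \<and> adj w u} = {x, z}"
    and \<psi>: "\<And>\<psi>. \<psi> \<in> E \<Longrightarrow> \<psi> x + \<psi> z = \<psi> y + \<psi> w"
  have "z \<in> {u. adj y u \<and> adj w u}" unfolding c by simp
  then have yz: "adj y z" and wz: "adj w z" by simp_all
  have "u = x \<or> u = z" if "adj y u" "adj w u" for u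
  proof -
    have "u \<in> {u. adj y u \<and> adj w u}" using that by simp
    then show ?thesis unfolding c by simp
  qed
  with z yz wz \<psi> show thesis by (rule that)
qed

text \<open>
  The vertex opposite to \<open>x\<close> in the 4-cycle spanned by \<open>x y\<close> and \<open>x w\<close> is determined.
\<close>

lemma square_unique:
  assumes "adj x y" "h x \<noteq> h y" "adj x w" "w \<noteq> y" "adj y u" "adj w u" "u \<noteq> x" "adj y v" "adj w v" "v \<noteq> x"
  shows "u = v"
proof (rule square[OF assms(1-4)])
  fix z assume "\<And>u. adj y u \<Longrightarrow> adj w u \<Longrightarrow> u = x \<or> u = z"
  from this[OF assms(5,6)] this[OF assms(8,9)] assms(7,10) show ?thesis by simp
qed

lemma square_h:
  assumes "adj x y" "h x \<noteq> h y" "adj x w" "w \<noteq> y"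
  obtains z where "z \<noteq> x" "adj y z" "adj w z" "h x + h z = h y + h w"
proof (rule square[OF assms])
  fix z assume z: "z \<noteq> x" "adj y z" "adj w z" and \<psi>: "\<And>\<psi>. \<psi> \<in> E \<Longrightarrow> \<psi> x + \<psi> z = \<psi> y + \<psi> w"
  show thesis by (rule that[OF z \<psi>[OF h_eig]])
qed

text \<open>
  The following five lemmas specialise \<open>square_h\<close> to the possible directions of the two given edges.
  The parallelogram law shows that opposite edges of the 4-cycle change the height by the same amount,
  so they have the same direction.
\<close>

lemma up_diamond:
  assumes "up x y" "up x w" "y \<noteq> w"
  obtains z where "up y z" "up w z"
proof -
  have "adj x y" "h x \<noteq> h y" "adj x w" "w \<noteq> y"
    using assms up_adj[OF assms(1)] up_adj[OF assms(2)] by auto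
  then obtain z where z: "adj y z" "adj w z" "h x + h z = h y + h w"
    by (rule square_h)
  then have "up y z" "up w z"
    using up_adj[OF assms(1)] up_adj[OF assms(2)] by (auto simp: up_def)
  then show thesis by (rule that)
qed

lemma down_diamond:
  assumes "up y x" "up w x" "y \<noteq> w"
  obtains z where "up z y" "up z w"
proof -
  have "adj x y" "h x \<noteq> h y" "adj x w" "w \<noteq> y"
    using assms up_adj[OF assms(1)] up_adj[OF assms(2)] by auto
  then obtain z where z: "adj y z" "adj w z" "h x + h z = h y + h w"
    by (rule square_h)
  then have "up z y" "up z w"
    using up_adj[OF assms(1)] up_adj[OF assms(2)] by (auto simp: up_def intro: adj_sym)
  then show thesis by (rule that)
qed

lemma path_diamond:
  assumes "up x y" "up w x"
  obtains z where "z \<noteq> x" "up w z" "up z y"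
proof -
  have "adj x y" "h x \<noteq> h y" "adj x w" "w \<noteq> y"
    using up_adj[OF assms(1)] up_adj[OF assms(2)] by auto
  then obtain z where z: "z \<noteq> x" "adj y z" "adj w z" "h x + h z = h y + h w"
    by (rule square_h)
  then have "up w z" "up z y"
    using up_adj[OF assms(1)] up_adj[OF assms(2)] by (auto simp: up_def intro: adj_sym)
  then show thesis by (rule that[OF z(1)])
qed

lemma flat_push:
  assumes "up x y" "flat x w"
  obtains z where "flat y z" "up w z"
proof -
  have "adj x y" "h x \<noteq> h y" "adj x w" "w \<noteq> y"
    using up_adj[OF assms(1)] flat_adj[OF assms(2)] by auto
  then obtain z where z: "adj y z" "adj w z" "h x + h z = h y + h w"
    by (rule square_h)
  then have "flat y z" "up w z"
    using up_adj[OF assms(1)] flat_adj[OF assms(2)] by (auto simp: up_def flat_def)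
  then show thesis by (rule that)
qed

lemma flat_pull:
  assumes "up x y" "flat y z"
  obtains w where "flat x w" "up w z"
proof -
  have "adj y x" "h y \<noteq> h x" "adj y z" "z \<noteq> x"
    using up_adj[OF assms(1)] flat_adj[OF assms(2)] by auto
  then obtain w where w: "adj x w" "adj z w" "h y + h w = h x + h z"
    by (rule square_h)
  then have "flat x w" "up w z"
    using up_adj[OF assms(1)] flat_adj[OF assms(2)] by (auto simp: up_def flat_def intro: adj_sym)
  then show thesis by (rule that)
qed

lemma up_induct [case_names up]:
  assumes "\<And>x. (\<And>y. up x y \<Longrightarrow> P y) \<Longrightarrow> P x"
  shows "P x"
proof (induction "card {v \<in> V. h x < h v}" arbitrary: x rule: less_induct)
  case less
  show ?case
  proof (rule assms)
    fix y assume "up x y"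
    then have "{v \<in> V. h y < h v} \<subset> {v \<in> V. h x < h v}"
      using up_V[of x y] unfolding up_def by auto
    then show "P y" by (intro less psubset_card_mono) auto
  qed
qed

lemma ex_summit:
  assumes "x \<in> V"
  shows "\<exists>t. up\<^sup>*\<^sup>* x t \<and> summit t"
  using assms
proof (induction x rule: up_induct)
  case (up x)
  show ?case
  proof (cases "summit x")
    case True
    then show ?thesis by blast
  next
    case False
    then obtain y where y: "up x y" using up.prems unfolding summit_def by blast
    obtain t where "up\<^sup>*\<^sup>* y t" "summit t" using up.IH[OF y up_V(2)[OF y]] by blast
    then show ?thesis using converse_rtranclp_into_rtranclp[of up, OF y] by blast
  qed
qed

text \<open>
  Newman's argument: two ascending paths that diverge at \<open>x\<close> are joined by a diamond one step above,
  and the induction hypothesis applies to both upper neighbours.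
\<close>

lemma summit_unique:
  "up\<^sup>*\<^sup>* x s \<Longrightarrow> summit s \<Longrightarrow> up\<^sup>*\<^sup>* x t \<Longrightarrow> summit t \<Longrightarrow> s = t"
proof (induction x arbitrary: s t rule: up_induct)
  case (up x)
  from \<open>up\<^sup>*\<^sup>* x s\<close> show ?case
  proof (cases rule: converse_rtranclpE)
    case base
    with \<open>up\<^sup>*\<^sup>* x t\<close> \<open>summit s\<close> show ?thesis
      by (auto simp: summit_def elim: converse_rtranclpE)
  next
    case (step y)
    from \<open>up\<^sup>*\<^sup>* x t\<close> show ?thesis
    proof (cases rule: converse_rtranclpE)
      case base
      with \<open>up x y\<close> \<open>summit t\<close> show ?thesis by (simp add: summit_def)
    next
      case (step w)
      show ?thesis
      proof (cases "w = y")
        case True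
        with \<open>up x y\<close> \<open>up\<^sup>*\<^sup>* y s\<close> \<open>up\<^sup>*\<^sup>* w t\<close> up.prems show ?thesis by (intro up.IH[of y]) simp_all
      next
        case False
        obtain z where z: "up w z" "up y z"
          using up_diamond[OF \<open>up x w\<close> \<open>up x y\<close> False] .
        obtain r where r: "up\<^sup>*\<^sup>* z r" "summit r"
          using ex_summit[OF up_V(2)[OF z(1)]] by blast
        have "s = r"
          by (rule up.IH[OF \<open>up x y\<close> \<open>up\<^sup>*\<^sup>* y s\<close> \<open>summit s\<close> converse_rtranclp_into_rtranclp[of up, OF z(2) r(1)] r(2)])
        moreover have "t = r"
          by (rule up.IH[OF \<open>up x w\<close> \<open>up\<^sup>*\<^sup>* w t\<close> \<open>summit t\<close> converse_rtranclp_into_rtranclp[of up, OF z(1) r(1)] r(2)])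
        ultimately show ?thesis by simp
      qed
    qed
  qed
qed

definition top :: "'a \<Rightarrow> 'a" where
  "top x = (SOME t. up\<^sup>*\<^sup>* x t \<and> summit t)"

lemma top: "x \<in> V \<Longrightarrow> up\<^sup>*\<^sup>* x (top x)" "x \<in> V \<Longrightarrow> summit (top x)"
  using someI_ex[OF ex_summit[of x]] unfolding top_def by auto

lemma top_unique: "x \<in> V \<Longrightarrow> up\<^sup>*\<^sup>* x t \<Longrightarrow> summit t \<Longrightarrow> top x = t"
  by (rule summit_unique[OF top])

lemma top_summit: "summit t \<Longrightarrow> top t = t"
  by (rule top_unique) (auto simp: summit_def)

lemma top_up: "up x y \<Longrightarrow> top x = top y"
  using top[of y] up_V[of x y] by (intro top_unique) (auto intro: converse_rtranclp_into_rtranclp)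

lemma flat_summit: "flat x w \<Longrightarrow> summit x \<Longrightarrow> summit w"
  unfolding summit_def
proof (intro conjI allI notI)
  assume xw: "flat x w" and x: "x \<in> V \<and> (\<forall>y. \<not> up x y)"
  show "w \<in> V" using flat_V[OF xw] by simp
  fix y assume "up w y"
  then obtain z where "up x z" using flat_push[OF _ flat_sym[OF xw]] by blast
  then show False using x by simp
qed

text \<open>
  Flat edges are pushed upwards until both ends are summits.
\<close>

lemma flat_top: "flat x w \<Longrightarrow> flat (top x) (top w)"
proof (induction x arbitrary: w rule: up_induct)
  case (up x)
  show ?case
  proof (cases "summit x")
    case True
    then show ?thesis using up.prems flat_summit[OF up.prems True] by (simp add: top_summit)
  next
    case False
    then obtain y where y: "up x y" using flat_V[OF up.prems] unfolding summit_def by blast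
    obtain z where z: "flat y z" "up w z" using flat_push[OF y up.prems] .
    then show ?thesis using up.IH[OF y z(1)] top_up[OF y] top_up[OF z(2)] by simp
  qed
qed

lemma top_neq: "flat x w \<Longrightarrow> top x \<noteq> top w"
  using flat_top[of x w] unfolding flat_def by auto

text \<open>
  Along one upward edge from \<open>x\<close> to \<open>y\<close>, 4-cycles match the flat neighbours of \<open>x\<close> with those of \<open>y\<close>:
  \<open>flat_push\<close> and \<open>flat_pull\<close> give both directions, and uniqueness of 4-cycles gives injectivity.
  Both ends of an upward edge have the same summit, so iterating leads to \<open>top x\<close>.
\<close>

lemma flat_bij: "x \<in> V \<Longrightarrow> bij_betw top {w. flat x w} {t. flat (top x) t}"
proof (induction x rule: up_induct)
  case (up x)
  show ?case
  proof (cases "summit x")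
    case True
    then have "top w = w" if "flat x w" for w using flat_summit[OF that] top_summit by blast
    then show ?thesis using top_summit[OF True] by (auto simp: bij_betw_def inj_on_def)
  next
    case False
    then obtain y where y: "up x y" using up.prems unfolding summit_def by blast
    have bij: "bij_betw top {w. flat y w} {t. flat (top x) t}"
      using up.IH[OF y] up_V[OF y] top_up[OF y] by simp
    have inj: "w = w'" if w: "flat x w" and w': "flat x w'" and eq: "top w = top w'" for w w'
    proof -
      obtain z where z: "flat y z" "up w z" using flat_push[OF y w] .
      obtain z' where z': "flat y z'" "up w' z'" using flat_push[OF y w'] .
      have "z = z'"
        using bij z z' eq top_up[OF z(2)] top_up[OF z'(2)] by (auto simp: bij_betw_def dest: inj_onD)
      show ?thesis
        by (rule square_unique[of y x z])
          (use up_adj[OF y] up_adj[OF z(2)] up_adj[OF z'(2)] flat_adj[OF w] flat_adj[OF w'] flat_adj[OF z(1)]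
            \<open>z = z'\<close> in auto)
    qed
    have surj: "t \<in> top ` {w. flat x w}" if "flat (top x) t" for t
    proof -
      have "t \<in> top ` {w. flat y w}" using bij that by (simp add: bij_betw_def)
      then obtain z where z: "flat y z" "t = top z" by blast
      obtain w where w: "flat x w" "up w z" using flat_pull[OF y z(1)] .
      show ?thesis using z(2) top_up[OF w(2)] w(1) by (intro image_eqI[of _ _ w]) simp_all
    qed
    show ?thesis
      unfolding bij_betw_def using inj surj flat_top by (auto simp: inj_on_def)
  qed
qed

text \<open>
  A lifted function does not change along edges that go up or down, and the flat edges at \<open>x\<close> are
  matched with those at \<open>top x\<close>.
\<close>

lemma Laplacian_lift:
  assumes x: "x \<in> V"
  shows "Laplacian G (\<lambda>u. f (top u)) x = (\<Sum>t | flat (top x) t. f t - f (top x))"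
proof -
  have "Laplacian G (\<lambda>u. f (top u)) x = (\<Sum>w | adj x w. f (top w) - f (top x))"
    unfolding Laplacian_eq by (rule sum_A)
  also have "\<dots> = (\<Sum>w | flat x w. f (top w) - f (top x))"
  proof (rule sum.mono_neutral_right)
    show "\<forall>w\<in>{w. adj x w} - {w. flat x w}. f (top w) - f (top x) = 0"
      using adj_cases[of x] top_up by fastforce
  qed (auto simp: flat_def)
  also have "\<dots> = (\<Sum>t | flat (top x) t. f t - f (top x))"
    by (rule sum.reindex_bij_betw[OF flat_bij[OF x]])
  finally show ?thesis .
qed

end

section \<open>Families of sets that meet like the facets of a simplex\<close>

lemma card_eq_by_relation:
  assumes fin: "finite A" "finite B"
    and ex: "\<And>u. u \<in> A \<Longrightarrow> \<exists>z\<in>B. R u z" "\<And>z. z \<in> B \<Longrightarrow> \<exists>u\<in>A. R u z"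
    and un: "\<And>u z z'. u \<in> A \<Longrightarrow> z \<in> B \<Longrightarrow> z' \<in> B \<Longrightarrow> R u z \<Longrightarrow> R u z' \<Longrightarrow> z = z'"
      "\<And>u u' z. u \<in> A \<Longrightarrow> u' \<in> A \<Longrightarrow> z \<in> B \<Longrightarrow> R u z \<Longrightarrow> R u' z \<Longrightarrow> u = u'"
  shows "card A = card B"
proof -
  obtain f where f: "\<And>u. u \<in> A \<Longrightarrow> f u \<in> B \<and> R u (f u)"
    using ex(1) by metis
  have inj: "inj_on f A"
  proof (rule inj_onI)
    fix u u' assume "u \<in> A" "u' \<in> A" "f u = f u'"
    then show "u = u'" using un(2)[of u u' "f u"] f[of u] f[of u'] by simp
  qed
  have "f ` A = B"
  proof (rule set_eqI, rule iffI)
    fix z assume "z \<in> B"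
    then obtain u where "u \<in> A" "R u z" using ex(2) by blast
    then have "z = f u" using un(1)[of u z "f u"] f[of u] \<open>z \<in> B\<close> by simp
    then show "z \<in> f ` A" using \<open>u \<in> A\<close> by simp
  qed (use f in auto)
  then show ?thesis using card_image[OF inj] by simp
qed

lemma card_1_diff:
  assumes "finite A" "card A = Suc m" "card (A \<inter> B) = m"
  obtains p where "p \<in> A" "p \<notin> B" "A \<inter> B = A - {p}"
proof -
  have "card (A - B) = 1"
    using assms card_Diff_subset_Int[of A B] by simp
  then obtain p where p: "A - B = {p}" by (auto simp: card_1_singleton_iff)
  have "p \<in> A - B" unfolding p by simp
  moreover have "A \<inter> B = A - {p}" using p by blast
  ultimately show thesis using that by blast
qed

text \<open>
  Sets of size \<open>m + 1\<close> that pairwise meet in \<open>m\<close> elements either all contain one set of size \<open>m\<close> or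
  all lie in one set of size \<open>m + 2\<close>. The last hypothesis excludes the first alternative, even for
  three of the sets; as there are \<open>m + 2\<close> sets, they are all the facets of their union.
  Relative to a fixed \<open>S y0\<close>, any other set arises by exchanging one element \<open>p w\<close> of \<open>S y0\<close> for a
  new element \<open>b w\<close>. The hypothesis makes \<open>p\<close> a bijection onto \<open>S y0\<close>, and two different new
  elements would make the intersection of two sets too small.
\<close>

lemma simplex_facets:
  fixes S :: "'i \<Rightarrow> 'b set"
  assumes U: "finite U" "card U = Suc (Suc m)"
    and S: "\<And>y. y \<in> U \<Longrightarrow> finite (S y)" "\<And>y. y \<in> U \<Longrightarrow> card (S y) = Suc m"
    and int: "\<And>y w. y \<in> U \<Longrightarrow> w \<in> U \<Longrightarrow> y \<noteq> w \<Longrightarrow> card (S y \<inter> S w) = m"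
    and star: "\<And>y w v. y \<in> U \<Longrightarrow> w \<in> U \<Longrightarrow> v \<in> U \<Longrightarrow> y \<noteq> w \<Longrightarrow> y \<noteq> v \<Longrightarrow>
      S y \<inter> S w = S y \<inter> S v \<Longrightarrow> w = v"
  shows "card (\<Union>(S ` U)) = Suc (Suc m)"
    and "\<And>a. a \<in> \<Union>(S ` U) \<Longrightarrow> \<exists>y\<in>U. S y = \<Union>(S ` U) - {a}"
proof -
  obtain y0 where y0: "y0 \<in> U" using U by fastforce
  define U' where "U' = U - {y0}"
  have cU': "card U' = Suc m" and fU': "finite U'" using U y0 by (simp_all add: U'_def)
  have U'D: "w \<in> U" "w \<noteq> y0" if "w \<in> U'" for w using that by (auto simp: U'_def)
  have "\<exists>p. p \<in> S y0 \<and> p \<notin> S w \<and> S y0 \<inter> S w = S y0 - {p}" if "w \<in> U'" for w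
    using card_1_diff[OF S[OF y0] int[OF y0 U'D(1)[OF that]]] U'D(2)[OF that] by metis
  then obtain p where p: "\<And>w. w \<in> U' \<Longrightarrow> p w \<in> S y0 \<and> p w \<notin> S w \<and> S y0 \<inter> S w = S y0 - {p w}"
    by metis
  have "\<exists>b. b \<in> S w \<and> b \<notin> S y0 \<and> S w \<inter> S y0 = S w - {b}" if "w \<in> U'" for w
    using card_1_diff[OF S[OF U'D(1)[OF that]] int[OF U'D(1)[OF that] y0]] U'D(2)[OF that] by metis
  then obtain b where b: "\<And>w. w \<in> U' \<Longrightarrow> b w \<in> S w \<and> b w \<notin> S y0 \<and> S w \<inter> S y0 = S w - {b w}"
    by metis
  have Sw: "S w = insert (b w) (S y0 - {p w})" if "w \<in> U'" for w
  proof -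
    have "S w = insert (b w) (S w - {b w})" using b[OF that] by (simp add: insert_absorb)
    also have "S w - {b w} = S y0 - {p w}" using b[OF that] p[OF that] by (simp add: Int_commute)
    finally show ?thesis .
  qed
  have p_inj: "inj_on p U'"
  proof (rule inj_onI)
    fix w v assume w: "w \<in> U'" and v: "v \<in> U'" and "p w = p v"
    then have "S y0 \<inter> S w = S y0 \<inter> S v" using p[OF w] p[OF v] by simp
    then show "w = v" using star[OF y0 U'D(1)[OF w] U'D(1)[OF v]] U'D(2)[OF w] U'D(2)[OF v] by simp
  qed
  have p_surj: "p ` U' = S y0"
  proof (rule card_subset_eq[OF S(1)[OF y0]])
    show "p ` U' \<subseteq> S y0" using p by (simp add: image_subset_iff)
    show "card (p ` U') = card (S y0)" using card_image[OF p_inj] cU' S(2)[OF y0] by simp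
  qed
  have b_const: "b w = b v" if w: "w \<in> U'" and v: "v \<in> U'" for w v
  proof (rule ccontr)
    assume ne: "b w \<noteq> b v"
    then have wv: "w \<noteq> v" by auto
    then have pp: "p w \<noteq> p v" using p_inj w v by (auto dest: inj_onD)
    have "S w \<inter> S v = S y0 - {p w, p v}"
    proof -
      have "b w \<notin> S y0" "b v \<notin> S y0" using b[OF w] b[OF v] by simp_all
      then show ?thesis unfolding Sw[OF w] Sw[OF v] using ne by auto
    qed
    moreover have "card (S y0 - {p w, p v}) = Suc m - 2"
      using p[OF w] p[OF v] pp S[OF y0] by (subst card_Diff_subset) auto
    moreover have "card (S w \<inter> S v) = m" using int[OF U'D(1)[OF w] U'D(1)[OF v] wv] .
    moreover have "card {p w, p v} \<le> card (S y0)"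
      using p[OF w] p[OF v] S(1)[OF y0] by (intro card_mono) auto
    ultimately show False using pp S(2)[OF y0] by simp
  qed
  obtain w0 where w0: "w0 \<in> U'" using cU' by fastforce
  have Sw': "S w = insert (b w0) (S y0 - {p w})" if "w \<in> U'" for w
    using Sw[OF that] b_const[OF that w0] by simp
  have "U = insert y0 U'" using y0 by (auto simp: U'_def)
  then have "\<Union>(S ` U) = S y0 \<union> (\<Union>w\<in>U'. S w)" by simp
  also have "\<dots> = insert (b w0) (S y0)"
  proof -
    have "S w \<subseteq> insert (b w0) (S y0)" if "w \<in> U'" for w unfolding Sw'[OF that] by auto
    moreover have "b w0 \<in> (\<Union>w\<in>U'. S w)" using b[OF w0] w0 by (intro UN_I[of w0]) simp_all
    ultimately show ?thesis by auto
  qed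
  finally have un: "\<Union>(S ` U) = insert (b w0) (S y0)" .
  show "card (\<Union>(S ` U)) = Suc (Suc m)"
    unfolding un using b[OF w0] S[OF y0] by simp
  fix a assume "a \<in> \<Union>(S ` U)"
  then consider "a = b w0" | "a \<in> S y0" "a \<noteq> b w0" unfolding un by blast
  then show "\<exists>y\<in>U. S y = \<Union>(S ` U) - {a}"
  proof cases
    case 1
    have "S y0 = insert (b w0) (S y0) - {a}" using 1 b[OF w0] by simp
    then show ?thesis unfolding un using y0 by (intro bexI[of _ y0])
  next
    case 2
    then have "a \<in> p ` U'" using p_surj by simp
    then obtain w where w: "w \<in> U'" "a = p w" by (elim imageE)
    have "S w = insert (b w0) (S y0) - {a}" unfolding Sw'[OF w(1)] using 2 w(2) by auto
    then show ?thesis unfolding un using U'D(1)[OF w(1)] by (intro bexI[of _ w])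
  qed
qed

section \<open>The graph on the summits\<close>

context height_graph
begin

definition base :: "'a pair_pre_digraph" where
  "base = \<lparr> pverts = {t. summit t}, parcs = {(s, t). summit s \<and> summit t \<and> adj s t} \<rparr>"

lemma base_simps [simp]:
  "pverts base = {t. summit t}" "parcs base = {(s, t). summit s \<and> summit t \<and> adj s t}"
  by (simp_all add: base_def)

lemma summit_V: "summit t \<Longrightarrow> t \<in> V"
  by (simp add: summit_def)

lemma summit_adj_flat: "summit s \<Longrightarrow> summit t \<Longrightarrow> adj s t \<Longrightarrow> flat s t"
  using adj_cases[of s t] by (auto simp: summit_def)

lemma flat_base: "summit s \<Longrightarrow> {t. (s, t) \<in> parcs base} = {t. flat s t}"
proof (intro Collect_cong iffI)
  fix t assume s: "summit s"
  show "(s, t) \<in> parcs base" if "flat s t"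
    using s flat_summit[OF that s] flat_adj(1)[OF that] by simp
  show "flat s t" if "(s, t) \<in> parcs base"
    using that summit_adj_flat[of s t] by simp
qed

lemma Laplacian_base: "x \<in> V \<Longrightarrow> Laplacian G (\<lambda>u. f (top u)) x = Laplacian base f (top x)"
  unfolding Laplacian_lift Laplacian_def[of base] flat_base[OF top(2)] ..

lemma Gamma_base: "x \<in> V \<Longrightarrow> Gamma G (\<lambda>u. f (top u)) (\<lambda>u. g (top u)) x = Gamma base f g (top x)"
  unfolding Gamma_def by (simp add: Laplacian_base Laplacian_base[of x "\<lambda>t. f t * g t"])

text \<open>
  All operators of the Bakry-Emery calculus are built from the Laplacian, so lifting intertwines them too.
\<close>

lemma Gamma2_base:
  assumes x: "x \<in> V"
  shows "Gamma2 G (\<lambda>u. f (top u)) (\<lambda>u. f (top u)) x = Gamma2 base f f (top x)"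
proof -
  have "Laplacian G (Gamma G (\<lambda>u. f (top u)) (\<lambda>u. f (top u))) x = Laplacian G (\<lambda>u. Gamma base f f (top u)) x"
    by (rule Laplacian_cong[OF x]) (rule Gamma_base)
  also have "\<dots> = Laplacian base (Gamma base f f) (top x)"
    by (rule Laplacian_base[OF x])
  finally have 1: "Laplacian G (Gamma G (\<lambda>u. f (top u)) (\<lambda>u. f (top u))) x = Laplacian base (Gamma base f f) (top x)" .
  have "Gamma G (\<lambda>u. f (top u)) (Laplacian G (\<lambda>u. f (top u))) x
      = Gamma G (\<lambda>u. f (top u)) (\<lambda>u. Laplacian base f (top u)) x"
    by (rule Gamma_cong[OF x]) (simp_all add: Laplacian_base)
  also have "\<dots> = Gamma base f (Laplacian base f) (top x)"
    by (rule Gamma_base[OF x])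
  finally show ?thesis unfolding Gamma2_def using 1 by simp
qed

lemma CD2_base: "CD_inf base 2"
  unfolding CD_inf_def
proof (intro allI ballI)
  fix f t assume "t \<in> pverts base"
  then have t: "summit t" by simp
  have "Gamma2 G (\<lambda>u. f (top u)) (\<lambda>u. f (top u)) t \<ge> 2 * Gamma G (\<lambda>u. f (top u)) (\<lambda>u. f (top u)) t"
    using CD2 summit_V[OF t] unfolding CD_inf_def by blast
  then show "Gamma2 base f f t \<ge> 2 * Gamma base f f t"
    using summit_V[OF t] by (simp add: Gamma2_base Gamma_base top_summit[OF t])
qed

text \<open>
  The map \<open>top\<close> sends each edge to an edge of the base or to a single vertex, so paths descend.
\<close>

lemma connected_base: "connected_graph base"
proof (rule connected_graphI)
  show "pair_graph base"
  proof
    show "finite (pverts base)"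
      by (rule finite_subset[OF _ finite_V]) (auto simp: summit_V)
    then show "finite (parcs base)"
      by (intro finite_subset[of "parcs base" "pverts base \<times> pverts base"]) auto
    show "symmetric (with_proj base)"
      unfolding symmetric_def with_proj_simps by (rule symI) (simp add: adj_sym)
  qed auto
  show "pverts base \<noteq> {}" using V_nonempty top(2) by fastforce
next
  fix s t P assume s: "s \<in> pverts base" and P: "P s" and step: "\<And>y z. P y \<Longrightarrow> (y, z) \<in> parcs base \<Longrightarrow> P z"
    and t: "t \<in> pverts base"
  have "P (top t)"
  proof (rule connected_induct[of s "\<lambda>x. P (top x)" t])
    fix y z assume Py: "P (top y)" and yz: "adj y z"
    then consider "up y z" | "up z y" | "flat y z" using adj_cases by blast
    then show "P (top z)"
    proof cases
      case 3
      then have "(top y, top z) \<in> parcs base"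
        using flat_top[OF 3] flat_V[OF 3] top(2) flat_adj(1) by simp
      then show ?thesis by (rule step[OF Py])
    qed (use Py top_up[of y z] top_up[of z y] in simp_all)
  qed (use s P t in \<open>simp_all add: top_summit summit_V\<close>)
  then show "P t" using t by (simp add: top_summit)
qed

end

section \<open>Labelling a fibre by sets\<close>

lemma card_symdiff_1:
  "card ((P - Q) \<union> (Q - P)) = 1 \<longleftrightarrow> (\<exists>b. b \<notin> Q \<and> P = insert b Q) \<or> (\<exists>b. b \<notin> P \<and> Q = insert b P)"
proof
  assume "card ((P - Q) \<union> (Q - P)) = 1"
  then obtain b where b: "(P - Q) \<union> (Q - P) = {b}" by (auto simp: card_1_singleton_iff)
  then have iff: "(v \<in> P) \<noteq> (v \<in> Q) \<longleftrightarrow> v = b" for v by blast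
  show "(\<exists>b. b \<notin> Q \<and> P = insert b Q) \<or> (\<exists>b. b \<notin> P \<and> Q = insert b P)"
  proof (cases "b \<in> P")
    case True
    then have "b \<notin> Q" using iff[of b] by simp
    moreover have "v \<in> P \<longleftrightarrow> v \<in> insert b Q" for v
      using iff[of v] True by (cases "v = b") simp_all
    ultimately show ?thesis by (intro disjI1 exI[of _ b] conjI set_eqI)
  next
    case False
    have "v \<in> Q \<longleftrightarrow> v \<in> insert b P" for v
      using iff[of v] iff[of b] False by (cases "v = b") simp_all
    then show ?thesis using False by (intro disjI2 exI[of _ b] conjI set_eqI)
  qed
next
  assume "(\<exists>b. b \<notin> Q \<and> P = insert b Q) \<or> (\<exists>b. b \<notin> P \<and> Q = insert b P)"
  then consider b where "b \<notin> Q" "P = insert b Q" | b where "b \<notin> P" "Q = insert b P"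
    by (elim disjE exE conjE)
  then show "card ((P - Q) \<union> (Q - P)) = 1"
  proof cases
    case (1 b)
    then have "(P - Q) \<union> (Q - P) = {b}" by auto
    then show ?thesis by simp
  next
    case (2 b)
    then have "(P - Q) \<union> (Q - P) = {b}" by auto
    then show ?thesis by simp
  qed
qed

context height_graph
begin

text \<open>
  The level turns out to be the distance to the summit in the fibre, and equally the size of the label.
\<close>

definition level :: "'a \<Rightarrow> nat" where
  "level x = card {y. up x y}"

definition below :: "'a \<Rightarrow> 'a set" where
  "below t = {a. up a t}"

text \<open>
  The vertices directly below the summit serve as the coordinates of the fibre.
\<close>

definition label :: "'a \<Rightarrow> 'a set" where
  "label x = {a \<in> below (top x). up\<^sup>*\<^sup>* x a}"

lemma finite_up [simp]: "finite {y. up x y}"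
  by (rule finite_subset[OF _ finite_V]) (auto dest: up_V)

lemma finite_below [simp]: "finite (below t)"
  unfolding below_def by (rule finite_subset[OF _ finite_V]) (auto dest: up_V)

lemma finite_label [simp]: "finite (label x)"
  unfolding label_def by simp

text \<open>
  In a diamond with bottom \<open>x\<close>, sides \<open>y, w\<close> and top \<open>z\<close>, the two sides determine the top and the
  bottom, and the top and the bottom determine the sides.
\<close>

lemma up_square_unique:
  assumes "up y z" "up w z" "up x y" "up x w" "y \<noteq> w"
  shows "up y u \<Longrightarrow> up w u \<Longrightarrow> u = z"
    and "up x v \<Longrightarrow> up v z \<Longrightarrow> v = y \<or> v = w"
    and "up v y \<Longrightarrow> up v w \<Longrightarrow> v = x"
proof -
  have h: "h x < h y" "h x < h w" "h y < h z" "h w < h z" using assms by (simp_all add: up_def)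
  have ne: "h x \<noteq> h y" "h y \<noteq> h x" "h z \<noteq> h y" "z \<noteq> x" "x \<noteq> z" "w \<noteq> y" using h assms(5) by auto
  show "u = z" if "up y u" "up w u"
  proof -
    have "u \<noteq> x" using up_adj(3)[OF that(1)] h by auto
    then show ?thesis
      by (rule square_unique[OF up_adj(1)[OF assms(3)] ne(1) up_adj(1)[OF assms(4)] ne(6)
          up_adj(1)[OF that(1)] up_adj(1)[OF that(2)] _ up_adj(1)[OF assms(1)] up_adj(1)[OF assms(2)] ne(4)])
  qed
  show "v = y \<or> v = w" if "up x v" "up v z"
  proof (rule disjCI)
    assume "v \<noteq> w"
    have "h w \<noteq> h x" using h by simp
    then show "v = y"
      by (rule square_unique[OF up_adj(2)[OF assms(4)] _ up_adj(1)[OF assms(2)] ne(4)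
          up_adj(1)[OF that(1)] up_adj(2)[OF that(2)] \<open>v \<noteq> w\<close> up_adj(1)[OF assms(3)] up_adj(2)[OF assms(1)] assms(5)])
  qed
  show "v = x" if "up v y" "up v w"
  proof -
    have "v \<noteq> z" using up_adj(3)[OF that(1)] h by auto
    then show ?thesis
      by (rule square_unique[OF up_adj(2)[OF assms(1)] ne(3) up_adj(2)[OF assms(2)] ne(6)
          up_adj(2)[OF that(1)] up_adj(2)[OF that(2)] _ up_adj(2)[OF assms(3)] up_adj(2)[OF assms(4)] ne(5)])
  qed
qed

text \<open>
  For an edge from \<open>x\<close> up to \<open>y\<close>, diamonds match the other edges going up from \<open>x\<close> with all the
  edges going up from \<open>y\<close>.
\<close>

lemma level_up:
  assumes xy: "up x y"
  shows "level x = Suc (level y)"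
proof -
  have "card ({u. up x u} - {y}) = card {z. up y z}"
  proof (rule card_eq_by_relation[where R = up])
    show "\<exists>z\<in>{z. up y z}. up u z" if "u \<in> {u. up x u} - {y}" for u
    proof -
      have "up x u" "y \<noteq> u" using that by auto
      then obtain z where "up y z" "up u z" by (rule up_diamond[OF xy])
      then show ?thesis by blast
    qed
    show "\<exists>u\<in>{u. up x u} - {y}. up u z" if "z \<in> {z. up y z}" for z
    proof -
      have "up y z" using that by simp
      then obtain u where "u \<noteq> y" "up x u" "up u z" by (rule path_diamond[OF _ xy])
      then show ?thesis by blast
    qed
    show "z = z'" if "u \<in> {u. up x u} - {y}" "z \<in> {z. up y z}" "z' \<in> {z. up y z}" "up u z" "up u z'" for u z z'
      by (rule sym, rule up_square_unique(1)[of y z u x]) (use that xy in auto)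
    show "u = u'" if "u \<in> {u. up x u} - {y}" "u' \<in> {u. up x u} - {y}" "z \<in> {z. up y z}" "up u z" "up u' z" for u u' z
      using up_square_unique(2)[of y z u x u'] that xy by auto
  qed simp_all
  moreover have "card {u. up x u} = Suc (card ({u. up x u} - {y}))"
    by (rule card.remove) (simp_all add: xy)
  ultimately show ?thesis unfolding level_def by simp
qed

lemma level_0: "x \<in> V \<Longrightarrow> level x = 0 \<longleftrightarrow> summit x"
  unfolding level_def summit_def by (simp add: card_eq_0_iff)

lemma summit_rtranclp: "up\<^sup>*\<^sup>* x y \<Longrightarrow> summit x \<Longrightarrow> y = x"
  by (erule converse_rtranclpE) (auto simp: summit_def)

lemma level_below: "summit t \<Longrightarrow> a \<in> below t \<Longrightarrow> level a = 1"
  using level_up[of a t] level_0[of t] summit_V[of t] by (simp add: below_def)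

lemma top_below: "summit t \<Longrightarrow> a \<in> below t \<Longrightarrow> top a = t"
  using top_up[of a t] top_summit[of t] by (simp add: below_def)

lemma labelD: "a \<in> label x \<Longrightarrow> a \<in> below (top x)" "a \<in> label x \<Longrightarrow> up\<^sup>*\<^sup>* x a"
  by (simp_all add: label_def)

lemma label_mono: "up x y \<Longrightarrow> label y \<subseteq> label x"
  unfolding label_def using top_up[of x y] by (auto intro: converse_rtranclp_into_rtranclp)

lemma label_summit: "summit x \<Longrightarrow> label x = {}"
proof (rule equals0I)
  fix a assume x: "summit x" and a: "a \<in> label x"
  have "a = x" using summit_rtranclp[OF labelD(2)[OF a] x] .
  then have "up x x" using labelD(1)[OF a] top_summit[OF x] by (simp add: below_def)
  then show False using x by (simp add: summit_def)
qed

lemma label_below: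
  assumes t: "summit t" and a: "a \<in> below t"
  shows "label a = {a}"
proof (rule set_eqI, rule iffI)
  fix b assume b: "b \<in> label a"
  have ta: "top a = t" by (rule top_below[OF t a])
  from labelD(2)[OF b] show "b \<in> {a}"
  proof (cases rule: converse_rtranclpE)
    case (step y)
    have "level y = 0" using level_up[OF step(1)] level_below[OF t a] by simp
    then have y: "summit y" using level_0[OF up_V(2)[OF step(1)]] by simp
    have "b = y" using summit_rtranclp[OF step(2) y] .
    then have "up y t" using labelD(1)[OF b] ta by (simp add: below_def)
    then show ?thesis using y by (simp add: summit_def)
  qed simp
next
  fix b assume "b \<in> {a}"
  then show "b \<in> label a" using a top_below[OF t a] by (simp add: label_def)
qed

lemma label_Union:
  assumes x: "x \<in> V" and level: "level x \<ge> 2"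
  shows "label x = (\<Union>y\<in>{y. up x y}. label y)"
proof (rule equalityI)
  show "(\<Union>y\<in>{y. up x y}. label y) \<subseteq> label x"
    by (intro UN_least label_mono) simp
  show "label x \<subseteq> (\<Union>y\<in>{y. up x y}. label y)"
  proof
    fix a assume a: "a \<in> label x"
    from labelD(2)[OF a] show "a \<in> (\<Union>y\<in>{y. up x y}. label y)"
    proof (cases rule: converse_rtranclpE)
      case base
      then show ?thesis using level_below[OF top(2)[OF x] labelD(1)[OF a]] level by simp
    next
      case (step y)
      then have "a \<in> label y" using labelD(1)[OF a] top_up[of x y] by (simp add: label_def)
      then show ?thesis using step(1) by blast
    qed
  qed
qed

text \<open>
  Strong induction on the level \<open>n\<close>, for two statements at once: labels have \<open>n\<close> elements, each of
  which can be removed by a step upwards, and labels separate the vertices of a fibre.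
  For \<open>n \<ge> 2\<close>, the label of \<open>x\<close> is the union of the labels of the \<open>n\<close> upper neighbours of \<open>x\<close>. Two of
  these labels have size \<open>n - 1\<close> and are distinct by injectivity at level \<open>n - 1\<close>, and the top of
  their diamond has a label of size \<open>n - 2\<close> inside both, so they meet exactly in it. If the label of
  \<open>y\<close> met those of two others in the same set, the two diamonds would have the same top, against the
  uniqueness of diamonds. So \<open>simplex_facets\<close> applies. For injectivity at level \<open>n\<close>, removing two
  different coordinates from a common label leads \<open>x\<close> and \<open>x'\<close> to the same pair of upper neighbours,
  which have only one common lower neighbour.
\<close>

lemma label_structure:
  "(\<forall>x\<in>V. level x = n \<longrightarrow> card (label x) = n \<and> (\<forall>b\<in>label x. \<exists>y. up x y \<and> label y = label x - {b}))
   \<and> (\<forall>x\<in>V. \<forall>x'\<in>V. level x = n \<longrightarrow> level x' = n \<longrightarrow> top x = top x' \<longrightarrow> label x = label x' \<longrightarrow> x = x')"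
proof (induction n rule: less_induct)
  case (less n)
  have IH_card: "card (label x) = level x" if "x \<in> V" "level x < n" for x
    using less[OF that(2)] that by blast
  have IH_inj: "x = x'" if "x \<in> V" "x' \<in> V" "level x < n" "level x' = level x" "top x = top x'" "label x = label x'" for x x'
    using less[OF that(3)] that by blast
  consider "n = 0" | "n = 1" | m where "n = Suc (Suc m)"
  proof -
    have "n = 0 \<or> n = 1 \<or> (\<exists>m. n = Suc (Suc m))" by presburger
    then show thesis using that by blast
  qed
  then show ?case
  \<comment> \<open>The levels 0 and 1, the summits and the vertices directly below them, lack the diamonds
      needed for the general step.\<close>
  proof cases
    case 1
    have "summit x" if "x \<in> V" "level x = n" for x using level_0[OF that(1)] that(2) 1 by simp
    then show ?thesis using 1 label_summit top_summit by simp
  next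
    case 2
    have low: "summit (top x)" "x \<in> below (top x)" if x: "x \<in> V" and n: "level x = n" for x
    proof -
      show s: "summit (top x)" by (rule top(2)[OF x])
      have "\<not> summit x" using level_0[OF x] n 2 by simp
      then obtain y where y: "up x y" using x by (auto simp: summit_def)
      then have "level y = 0" using level_up[OF y] n 2 by simp
      then have "summit y" using level_0[OF up_V(2)[OF y]] by simp
      then have "top x = y" using top_up[OF y] top_summit[of y] by simp
      then show "x \<in> below (top x)" using y by (simp add: below_def)
    qed
    have lab: "label x = {x}" if "x \<in> V" "level x = n" for x
      using label_below[OF low[OF that]] .
    have "\<exists>y. up x y \<and> label y = label x - {b}" if "x \<in> V" "level x = n" "b \<in> label x" for x b
    proof -
      have "up x (top x)" using low(2)[OF that(1,2)] by (simp add: below_def)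
      moreover have "label (top x) = label x - {b}"
        using label_summit[OF low(1)[OF that(1,2)]] lab[OF that(1,2)] that(3) by simp
      ultimately show ?thesis by blast
    qed
    then show ?thesis using lab 2 by simp
  next
    case (3 m)
    have facts: "card (label x) = n" "\<And>b. b \<in> label x \<Longrightarrow> \<exists>y. up x y \<and> label y = label x - {b}"
      if x: "x \<in> V" and n: "level x = n" for x
    proof -
      let ?U = "{y. up x y}"
      have levU: "level y = Suc m" "y \<in> V" "top y = top x" if "y \<in> ?U" for y
        using that level_up[of x y] n 3 up_V[of x y] top_up[of x y] by simp_all
      have cU: "card (label y) = Suc m" if "y \<in> ?U" for y
        using IH_card[OF levU(2)[OF that]] levU(1)[OF that] 3 by simp
      have meet: "\<exists>z. up y z \<and> up w z \<and> label y \<inter> label w = label z \<and> level z = m \<and> z \<in> V \<and> top z = top x"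
        if y: "y \<in> ?U" and w: "w \<in> ?U" and ne: "y \<noteq> w" for y w
      proof -
        obtain z where z: "up y z" "up w z" using up_diamond[of x y w] y w ne by auto
        have lz: "level z = m" "z \<in> V" "top z = top x"
          using level_up[OF z(1)] levU[OF y] up_V[OF z(1)] top_up[OF z(1)] by simp_all
        have cz: "card (label z) = m" using IH_card[OF lz(2)] lz(1) 3 by simp
        have sub: "label z \<subseteq> label y \<inter> label w" using label_mono[OF z(1)] label_mono[OF z(2)] by simp
        have "label y \<noteq> label w"
          using IH_inj[of y w] levU[OF y] levU[OF w] ne 3 by auto
        then have "label y \<inter> label w \<subset> label y"
          using card_subset_eq[OF finite_label[of w], of "label y"] cU[OF y] cU[OF w] by auto
        then have "card (label y \<inter> label w) < Suc m"
          using psubset_card_mono[OF finite_label[of y]] cU[OF y] by simp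
        then have "label z = label y \<inter> label w"
          using cz sub card_mono[OF _ sub] by (intro card_subset_eq) simp_all
        then show ?thesis using z lz by blast
      qed
      have 1: "card (label y \<inter> label w) = m" if "y \<in> ?U" "w \<in> ?U" "y \<noteq> w" for y w
        using meet[OF that] IH_card 3 by fastforce
      have 2: "w = v" if y: "y \<in> ?U" and w: "w \<in> ?U" and v: "v \<in> ?U" and ne: "y \<noteq> w" "y \<noteq> v"
        and eq: "label y \<inter> label w = label y \<inter> label v" for y w v
      proof -
        obtain z where z: "up y z" "up w z" "label y \<inter> label w = label z" "level z = m" "z \<in> V" "top z = top x"
          using meet[OF y w ne(1)] by blast
        obtain z' where z': "up y z'" "up v z'" "label y \<inter> label v = label z'" "level z' = m" "z' \<in> V" "top z' = top x"
          using meet[OF y v ne(2)] by blast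
        have "z = z'" using IH_inj[OF z(5) z'(5)] z z' eq 3 by simp
        have xs: "up x y" "up x w" "up x v" using y w v by simp_all
        then show ?thesis
          using up_square_unique(2)[OF z(1,2) xs(1,2) ne(1) xs(3) z'(2)[folded \<open>z = z'\<close>]] ne(2) by simp
      qed
      have fc: "finite ?U" "card ?U = Suc (Suc m)" using n 3 by (simp_all add: level_def)
      have lab: "label x = \<Union>(label ` ?U)" using label_Union[OF x] n 3 by simp
      show "card (label x) = n"
        unfolding lab 3 by (rule simplex_facets(1)[OF fc finite_label cU 1 2])
      show "\<exists>y. up x y \<and> label y = label x - {b}" if "b \<in> label x" for b
      proof -
        have "\<exists>y\<in>?U. label y = \<Union>(label ` ?U) - {b}"
          by (rule simplex_facets(2)[OF fc finite_label cU 1 2]) (use that lab in simp_all)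
        then show ?thesis unfolding lab[symmetric] by blast
      qed
    qed
    have inj: "x = x'" if x: "x \<in> V" "level x = n" and x': "x' \<in> V" "level x' = n" and t: "top x = top x'" and l: "label x = label x'" for x x'
    proof -
      have "\<not> card (label x) \<le> Suc 0" using facts(1)[OF x] 3 by simp
      then obtain a b where ab: "a \<in> label x" "b \<in> label x" "a \<noteq> b"
        by (meson card_le_Suc0_iff_eq finite_label)
      have parent: "\<exists>y. up x y \<and> up x' y \<and> label y = label x - {c}" if c: "c \<in> label x" for c
      proof -
        obtain y where y: "up x y" "label y = label x - {c}" using facts(2)[OF x c] by blast
        obtain y' where y': "up x' y'" "label y' = label x - {c}" using facts(2)[OF x', of c] c l by auto
        have "y = y'"
          by (rule IH_inj) (use y y' up_V[OF y(1)] up_V[OF y'(1)] level_up[OF y(1)] level_up[OF y'(1)] x x' t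
            top_up[OF y(1)] top_up[OF y'(1)] in simp_all)
        then show ?thesis using y y' by blast
      qed
      obtain y where y: "up x y" "up x' y" "label y = label x - {a}" using parent[OF ab(1)] by blast
      obtain w where w: "up x w" "up x' w" "label w = label x - {b}" using parent[OF ab(2)] by blast
      have "y \<noteq> w" using y(3) w(3) ab by auto
      obtain z where z: "up y z" "up w z" using up_diamond[OF y(1) w(1) \<open>y \<noteq> w\<close>] .
      show ?thesis
        by (rule sym, rule up_square_unique(3)[OF z y(1) w(1) \<open>y \<noteq> w\<close> y(2) w(2)])
    qed
    show ?thesis using facts inj by blast
  qed
qed

lemma card_label: "x \<in> V \<Longrightarrow> card (label x) = level x"
  using label_structure[of "level x"] by blast

lemma label_remove: "x \<in> V \<Longrightarrow> b \<in> label x \<Longrightarrow> \<exists>y. up x y \<and> label y = label x - {b}"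
  using label_structure[of "level x"] by blast

lemma label_inj: "x \<in> V \<Longrightarrow> x' \<in> V \<Longrightarrow> top x = top x' \<Longrightarrow> label x = label x' \<Longrightarrow> x = x'"
  using label_structure[of "level x"] card_label[of x] card_label[of x'] by auto

text \<open>
  The vertex with label \<open>S\<close> is the bottom of the diamond whose other vertices carry the labels
  \<open>S - {a}\<close>, \<open>S - {b}\<close> and \<open>S - {a, b}\<close>.
\<close>

lemma label_surj:
  assumes t: "summit t" and S: "S \<subseteq> below t"
  shows "\<exists>x\<in>V. top x = t \<and> label x = S"
  using S
proof (induction "card S" arbitrary: S rule: less_induct)
  case less
  have fin: "finite S" using less.prems finite_below finite_subset by blast
  consider "S = {}" | a where "S = {a}" | a b where "a \<in> S" "b \<in> S" "a \<noteq> b" by blast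
  then show ?case
  proof cases
    case 1
    then show ?thesis using label_summit[OF t] top_summit[OF t] summit_V[OF t] by blast
  next
    case 2
    then have "a \<in> below t" using less.prems by simp
    then show ?thesis using label_below[OF t] top_below[OF t] 2 up_V(1)[of a t] by (auto simp: below_def)
  next
    case 3
    have IH: "\<exists>x\<in>V. top x = t \<and> label x = S - A" if "A \<noteq> {}" "A \<subseteq> S" for A
    proof (rule less.hyps)
      show "card (S - A) < card S" using that fin by (intro psubset_card_mono) auto
      show "S - A \<subseteq> below t" using less.prems by blast
    qed
    obtain y where y: "y \<in> V" "top y = t" "label y = S - {a}" using IH[of "{a}"] 3 by auto
    obtain w where w: "w \<in> V" "top w = t" "label w = S - {b}" using IH[of "{b}"] 3 by auto
    obtain z where z: "z \<in> V" "top z = t" "label z = S - {a, b}" using IH[of "{a, b}"] 3 by auto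
    have yz: "up y z"
    proof -
      obtain z1 where z1: "up y z1" "label z1 = label y - {b}"
        using label_remove[OF y(1), of b] y(3) 3 by auto
      have "z1 = z"
        by (rule label_inj) (use z1 z y up_V[OF z1(1)] top_up[OF z1(1)] in auto)
      then show ?thesis using z1 by simp
    qed
    have wz: "up w z"
    proof -
      obtain z1 where z1: "up w z1" "label z1 = label w - {a}"
        using label_remove[OF w(1), of a] w(3) 3 by auto
      have "z1 = z"
        by (rule label_inj) (use z1 z w up_V[OF z1(1)] top_up[OF z1(1)] in auto)
      then show ?thesis using z1 by simp
    qed
    have "a \<in> label w" "a \<notin> label y" using y(3) w(3) 3 by simp_all
    then have "y \<noteq> w" by auto
    then obtain x where x: "up x y" "up x w" by (rule down_diamond[OF yz wz])
    have xV: "x \<in> V" using up_V[OF x(1)] by simp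
    have "label x = S"
    proof (rule sym, rule card_subset_eq)
      show "S \<subseteq> label x" using label_mono[OF x(1)] label_mono[OF x(2)] y(3) w(3) 3 by auto
      have "card S = Suc (card (S - {a}))" using 3 fin by (intro card.remove) auto
      then show "card S = card (label x)"
        using card_label[OF xV] card_label[OF y(1)] level_up[OF x(1)] y(3) by simp
    qed simp
    then show ?thesis using xV top_up[OF x(1)] y(2) by auto
  qed
qed

lemma up_iff_label:
  assumes x: "x \<in> V" and y: "y \<in> V" and t: "top x = top y"
  shows "up x y \<longleftrightarrow> (\<exists>b. b \<notin> label y \<and> label x = insert b (label y))"
proof
  assume xy: "up x y"
  have "card (label x) = Suc (card (label y))"
    using card_label[OF x] card_label[OF y] level_up[OF xy] by simp
  then have "card (label x - label y) = 1"
    using label_mono[OF xy] by (simp add: card_Diff_subset)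
  then obtain b where "label x - label y = {b}" by (auto simp: card_1_singleton_iff)
  then show "\<exists>b. b \<notin> label y \<and> label x = insert b (label y)"
    using label_mono[OF xy] by (intro exI[of _ b]) blast
next
  assume "\<exists>b. b \<notin> label y \<and> label x = insert b (label y)"
  then obtain b where b: "b \<notin> label y" "label x = insert b (label y)" by blast
  then obtain z where z: "up x z" "label z = label x - {b}" using label_remove[OF x, of b] by auto
  have "z = y"
    by (rule label_inj) (use z b y t up_V[OF z(1)] top_up[OF z(1)] in auto)
  then show "up x y" using z by simp
qed

lemma adj_iff_label:
  assumes x: "x \<in> V" and y: "y \<in> V" and t: "top x = top y"
  shows "adj x y \<longleftrightarrow> card ((label x - label y) \<union> (label y - label x)) = 1"
proof -
  have nf: "\<not> flat x y" using top_neq[of x y] t by auto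
  show ?thesis
    unfolding card_symdiff_1 using adj_cases[of x y] nf up_iff_label[OF x y t] up_iff_label[OF y x t[symmetric]] by argo
qed

section \<open>The bundle structure\<close>

sublocale base: connected_pair_graph base
  by unfold_locales (rule connected_base)

definition fibre :: "'a \<Rightarrow> 'a set" where
  "fibre t = {x \<in> V. top x = t}"

lemma fibreD: "x \<in> fibre t \<Longrightarrow> x \<in> V" "x \<in> fibre t \<Longrightarrow> top x = t"
  by (simp_all add: fibre_def)

lemma flat_top_inj:
  assumes "flat x w" "flat x w'" "top w = top w'"
  shows "w = w'"
  using flat_bij[OF flat_V(1)[OF assms(1)]] assms
  by (simp add: bij_betw_def inj_on_def)

text \<open>
  Flat edges match the vertices directly below two adjacent summits.
\<close>

lemma card_below_flat:
  assumes st: "flat s t"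
  shows "card (below s) = card (below t)"
proof (rule card_eq_by_relation[where R = flat])
  have pull: "\<exists>w\<in>below t. flat a w" if st: "flat s t" and a: "a \<in> below s" for s t a
  proof -
    have "up a s" using a by (simp add: below_def)
    then obtain w where "flat a w" "up w t" by (rule flat_pull[OF _ st])
    then show ?thesis by (auto simp: below_def)
  qed
  show "\<exists>w\<in>below t. flat a w" if "a \<in> below s" for a
    by (rule pull[OF st that])
  show "\<exists>a\<in>below s. flat a w" if w: "w \<in> below t" for w
    using pull[OF flat_sym[OF st] w] flat_sym[of w] by blast
  show "w = w'" if "w \<in> below t" "w' \<in> below t" "flat a w" "flat a w'" for a w w'
    using flat_top_inj[OF that(3,4)] that(1,2) top_up[of w t] top_up[of w' t] by (simp add: below_def)
  show "a = a'" if "a \<in> below s" "a' \<in> below s" "flat a w" "flat a' w" for a a' w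
    using flat_top_inj[OF flat_sym[OF that(3)] flat_sym[OF that(4)]] that(1,2) top_up[of a s] top_up[of a' s]
    by (simp add: below_def)
qed simp_all

lemma card_below:
  assumes s: "summit s" and t: "summit t"
  shows "card (below s) = card (below t)"
proof (rule base.constant_on_edges)
  fix x y assume "base.adj x y"
  then have "flat x y" using summit_adj_flat by (simp add: base.adj_def)
  then show "card (below x) = card (below y)" by (rule card_below_flat)
qed (use s t in simp_all)

text \<open>
  All summits have equally many vertices directly below them, so an arbitrary one is chosen.
\<close>

definition rank :: nat where
  "rank = card (below (SOME t. summit t))"

lemma card_below_rank: "summit t \<Longrightarrow> card (below t) = rank"
  unfolding rank_def by (rule card_below[OF _ someI])

text \<open>
  The unique flat neighbour of \<open>x\<close> in the fibre over \<open>t\<close>, if \<open>t\<close> is a flat neighbour of \<open>top x\<close>.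
\<close>

definition move :: "'a \<Rightarrow> 'a \<Rightarrow> 'a" where
  "move x t = (SOME w. flat x w \<and> top w = t)"

lemma move:
  assumes "x \<in> V" "flat (top x) t"
  shows "flat x (move x t)" "top (move x t) = t"
proof -
  have "t \<in> top ` {w. flat x w}"
    using flat_bij[OF assms(1)] assms(2) by (simp add: bij_betw_def)
  then have "\<exists>w. flat x w \<and> top w = t" by blast
  from someI_ex[OF this] show "flat x (move x t)" "top (move x t) = t"
    unfolding move_def by simp_all
qed

lemma move_eq: "flat x w \<Longrightarrow> top w = t \<Longrightarrow> move x t = w"
proof -
  assume xw: "flat x w" and t: "top w = t"
  have "flat (top x) t" using flat_top[OF xw] t by simp
  note m = move[OF flat_V(1)[OF xw] this]
  show "move x t = w" by (rule flat_top_inj[OF m(1) xw]) (simp add: m(2) t)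
qed

lemma move_fibre: "x \<in> fibre s \<Longrightarrow> flat s t \<Longrightarrow> move x t \<in> fibre t"
  using move[of x t] flat_V(2)[of x "move x t"] by (simp add: fibre_def)

lemma move_move: "x \<in> fibre s \<Longrightarrow> flat s t \<Longrightarrow> move (move x t) s = x"
  using move_eq[OF flat_sym[OF move(1)[of x t]], of s] by (simp add: fibre_def)

lemma adj_fibre: "x \<in> fibre t \<Longrightarrow> y \<in> fibre t \<Longrightarrow> adj x y \<longleftrightarrow> up x y \<or> up y x"
  using adj_cases[of x y] top_neq[of x y] by (auto simp: fibre_def)

text \<open>
  Inside a fibre all edges go up or down, and flat edges push upward edges to upward edges.
\<close>

lemma adj_move_imp:
  assumes x: "x \<in> fibre s" and y: "y \<in> fibre s" and st: "flat s t" and xy: "adj x y"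
  shows "adj (move x t) (move y t)"
proof -
  have lift: "up (move x t) (move y t)" if x: "x \<in> fibre s" and y: "y \<in> fibre s" and xy: "up x y" for x y
  proof -
    have m: "flat x (move x t)" "top (move x t) = t"
      using move[of x t] fibreD[OF x] st by simp_all
    obtain z where z: "flat y z" "up (move x t) z" by (rule flat_push[OF xy m(1)])
    have "move y t = z"
      by (rule move_eq[OF z(1)]) (use top_up[OF z(2)] m(2) in simp)
    then show ?thesis using z(2) by simp
  qed
  have "up x y \<or> up y x" using adj_fibre[OF x y] xy by simp
  then show ?thesis
  proof
    assume "up x y"
    then show ?thesis by (intro up_adj(1) lift[OF x y])
  next
    assume "up y x"
    then show ?thesis by (intro up_adj(2) lift[OF y x])
  qed
qed

lemma adj_move:
  assumes x: "x \<in> fibre s" and y: "y \<in> fibre s" and st: "flat s t"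
  shows "adj (move x t) (move y t) \<longleftrightarrow> adj x y"
  using adj_move_imp[OF x y st]
    adj_move_imp[OF move_fibre[OF x st] move_fibre[OF y st] flat_sym[OF st]]
  unfolding move_move[OF x st] move_move[OF y st] by blast

definition enum :: "'a \<Rightarrow> nat \<Rightarrow> 'a" where
  "enum t = (SOME f. bij_betw f {0..<rank} (below t))"

lemma enum: "summit t \<Longrightarrow> bij_betw (enum t) {0..<rank} (below t)"
proof -
  assume t: "summit t"
  have "\<exists>f. bij_betw f {0..<rank} (below t)"
    using ex_bij_betw_nat_finite[OF finite_below[of t]] unfolding card_below_rank[OF t] .
  then show ?thesis unfolding enum_def by (rule someI_ex)
qed

definition code :: "'a \<Rightarrow> bit list" where
  "code x = map (\<lambda>i. if enum (top x) i \<in> label x then 1 else 0) [0..<rank]"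

lemma length_code [simp]: "length (code x) = rank"
  by (simp add: code_def)

lemma code_nth: "i < rank \<Longrightarrow> code x ! i = (if enum (top x) i \<in> label x then 1 else 0)"
  by (simp add: code_def)

lemma label_fibre: "x \<in> fibre t \<Longrightarrow> label x \<subseteq> below t"
  by (auto simp: label_def fibre_def)

lemma code_bij:
  assumes t: "summit t"
  shows "bij_betw code (fibre t) {u. length u = rank}"
  unfolding bij_betw_def
proof (intro conjI inj_onI equalityI subsetI)
  fix x y assume x: "x \<in> fibre t" and y: "y \<in> fibre t" and eq: "code x = code y"
  have "b \<in> label x \<longleftrightarrow> b \<in> label y" if "b \<in> below t" for b
  proof -
    obtain i where i: "i < rank" "b = enum t i"
      using enum[OF t] \<open>b \<in> below t\<close> by (fastforce simp: bij_betw_def)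
    then show ?thesis
      using code_nth[OF i(1), of x] code_nth[OF i(1), of y] eq fibreD(2)[OF x] fibreD(2)[OF y]
      by (simp split: if_splits)
  qed
  then have "label x = label y"
    using label_fibre[OF x] label_fibre[OF y] by blast
  then show "x = y" using label_inj fibreD[OF x] fibreD[OF y] by simp
next
  fix u :: "bit list" assume "u \<in> code ` fibre t"
  then show "u \<in> {u. length u = rank}" by auto
next
  fix u :: "bit list" assume "u \<in> {u. length u = rank}"
  then have len: "length u = rank" by simp
  define S where "S = enum t ` {i \<in> {0..<rank}. u ! i = 1}"
  have "S \<subseteq> below t" using enum[OF t] unfolding S_def bij_betw_def by blast
  then obtain x where x: "x \<in> V" "top x = t" "label x = S"
    using label_surj[OF t] by blast
  have inS: "enum t i \<in> S \<longleftrightarrow> u ! i = 1" if "i < rank" for i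
    using that enum[OF t] unfolding S_def bij_betw_def by (auto simp: inj_on_eq_iff)
  have "code x = u"
    using len by (intro nth_equalityI) (simp_all add: code_nth x inS)
  then show "u \<in> code ` fibre t" using x by (auto simp: fibre_def)
qed

lemma adj_code:
  assumes t: "summit t" and x: "x \<in> fibre t" and y: "y \<in> fibre t"
  shows "(code x, code y) \<in> parcs (hypercube rank) \<longleftrightarrow> adj x y"
proof -
  let ?D = "(label x - label y) \<union> (label y - label x)"
  let ?I = "{i. i < rank \<and> code x ! i \<noteq> code y ! i}"
  have I: "?I = {i. i < rank \<and> enum t i \<in> ?D}"
    using fibreD(2)[OF x] fibreD(2)[OF y] by (auto simp: code_nth split: if_splits)
  have img: "enum t ` ?I = ?D"
  proof
    show "enum t ` ?I \<subseteq> ?D" unfolding I by blast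
    show "?D \<subseteq> enum t ` ?I"
    proof
      fix b assume b: "b \<in> ?D"
      then have "b \<in> below t"
        using label_fibre[OF x] label_fibre[OF y] by blast
      then have "b \<in> enum t ` {0..<rank}" using enum[OF t] by (simp add: bij_betw_def)
      then obtain i where "i < rank" "b = enum t i" by auto
      then show "b \<in> enum t ` ?I" unfolding I using b by blast
    qed
  qed
  have "inj_on (enum t) ?I"
    by (rule inj_on_subset[of _ "{0..<rank}"]) (use enum[OF t] in \<open>auto simp: bij_betw_def\<close>)
  then have "card ?I = card ?D" unfolding img[symmetric] by (rule card_image[symmetric])
  then have "(code x, code y) \<in> parcs (hypercube rank) \<longleftrightarrow> card ?D = 1"
    by (simp add: hypercube_def)
  also have "\<dots> \<longleftrightarrow> adj x y"
    by (rule adj_iff_label[symmetric]) (use fibreD[OF x] fibreD[OF y] in simp_all)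
  finally show ?thesis .
qed

definition decode :: "'a \<Rightarrow> bit list \<Rightarrow> 'a" where
  "decode t = inv_into (fibre t) code"

lemma decode:
  assumes t: "summit t" and u: "length u = rank"
  shows "decode t u \<in> fibre t" "code (decode t u) = u"
proof -
  have "u \<in> code ` fibre t" using code_bij[OF t] u by (simp add: bij_betw_def)
  then show "decode t u \<in> fibre t" "code (decode t u) = u"
    unfolding decode_def by (rule inv_into_into, rule f_inv_into_f)
qed

lemma decode_code: "summit t \<Longrightarrow> x \<in> fibre t \<Longrightarrow> decode t (code x) = x"
  unfolding decode_def using code_bij[of t] by (simp add: bij_betw_def)

text \<open>
  The transition map of the bundle: parallel transport along flat edges, read in the coordinates
  of the two fibres.
\<close>

definition transport :: "'a \<Rightarrow> 'a \<Rightarrow> bit list \<Rightarrow> bit list" where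
  "transport s t u = code (move (decode s u) t)"

lemma transport_transport:
  assumes st: "flat s t" and s: "summit s" and u: "length u = rank"
  shows "transport t s (transport s t u) = u"
proof -
  have t: "summit t" by (rule flat_summit[OF st s])
  have m: "move (decode s u) t \<in> fibre t" by (rule move_fibre[OF decode(1)[OF s u] st])
  show ?thesis
    unfolding transport_def decode_code[OF t m] move_move[OF decode(1)[OF s u] st] by (rule decode(2)[OF s u])
qed

lemma length_transport [simp]: "length (transport s t u) = rank"
  by (simp add: transport_def)

lemma transport_automorphism:
  assumes st: "flat s t" and s: "summit s"
  shows "graph_automorphism (hypercube rank) (transport s t)"
  unfolding graph_automorphism_def
proof (intro conjI ballI)
  have t: "summit t" by (rule flat_summit[OF st s])
  have vert: "pverts (hypercube rank) = {u. length u = rank}" by (simp add: hypercube_def)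
  show "bij_betw (transport s t) (pverts (hypercube rank)) (pverts (hypercube rank))"
    unfolding vert
    by (rule bij_betw_byWitness[where f' = "transport t s"])
      (use transport_transport[OF st s] transport_transport[OF flat_sym[OF st] t] in auto)
  fix u v assume "u \<in> pverts (hypercube rank)" "v \<in> pverts (hypercube rank)"
  then have u: "length u = rank" and v: "length v = rank" by (simp_all add: vert)
  note du = decode[OF s u] and dv = decode[OF s v]
  have "(transport s t u, transport s t v) \<in> parcs (hypercube rank) \<longleftrightarrow> adj (move (decode s u) t) (move (decode s v) t)"
    unfolding transport_def by (rule adj_code[OF t move_fibre[OF du(1) st] move_fibre[OF dv(1) st]])
  also have "\<dots> \<longleftrightarrow> adj (decode s u) (decode s v)"
    by (rule adj_move[OF du(1) dv(1) st])
  also have "\<dots> \<longleftrightarrow> (u, v) \<in> parcs (hypercube rank)"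
    using adj_code[OF s du(1) dv(1)] unfolding du(2) dv(2) by simp
  finally show "(transport s t u, transport s t v) \<in> parcs (hypercube rank) \<longleftrightarrow> (u, v) \<in> parcs (hypercube rank)" .
qed

lemma bundle_data_transport: "bundle_data base (hypercube rank) transport"
  unfolding bundle_data_def
proof (intro ballI, clarify, intro conjI ballI)
  fix s t assume "(s, t) \<in> parcs base"
  then have s: "summit s" and t: "flat s t" using summit_adj_flat by simp_all
  show "graph_automorphism (hypercube rank) (transport s t)"
    by (rule transport_automorphism[OF t s])
  fix u assume "u \<in> pverts (hypercube rank)"
  then show "transport t s (transport s t u) = u"
    by (intro transport_transport[OF t s]) (simp add: hypercube_def)
qed

definition chart :: "'a \<Rightarrow> 'a \<times> bit list" where
  "chart x = (top x, code x)"

lemma in_own_fibre: "x \<in> V \<Longrightarrow> x \<in> fibre (top x)"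
  by (simp add: fibre_def)

lemma chart_decode:
  assumes t: "summit t" and u: "length u = rank"
  shows "decode t u \<in> V" "chart (decode t u) = (t, u)"
  using decode[OF t u] by (simp_all add: chart_def fibre_def)

lemma chart_inj: "inj_on chart V"
proof (rule inj_onI)
  fix x y assume x: "x \<in> V" and y: "y \<in> V" and eq: "chart x = chart y"
  have "inj_on code (fibre (top x))" using code_bij[OF top(2)[OF x]] by (simp add: bij_betw_def)
  then show "x = y"
    by (rule inj_onD) (use x y eq in \<open>simp_all add: chart_def fibre_def\<close>)
qed

lemma chart_verts: "chart ` V = pverts (bundle_graph base (hypercube rank) transport)"
proof (intro equalityI subsetI)
  fix p assume "p \<in> chart ` V"
  then show "p \<in> pverts (bundle_graph base (hypercube rank) transport)"
    using top(2) by (auto simp: chart_def bundle_graph_def hypercube_def)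
next
  fix p assume "p \<in> pverts (bundle_graph base (hypercube rank) transport)"
  then obtain t u where p: "p = (t, u)" "summit t" "length u = rank"
    by (auto simp: bundle_graph_def hypercube_def)
  show "p \<in> chart ` V"
    using chart_decode[OF p(2,3)] unfolding p(1) by (intro image_eqI[of _ _ "decode t u"]) simp_all
qed

text \<open>
  Flat edges correspond to the edges of the bundle between different fibres, the other edges to
  those within a fibre.
\<close>

lemma chart_arcs: "map_prod chart chart ` parcs G = parcs (bundle_graph base (hypercube rank) transport)"
proof (intro equalityI subsetI)
  fix p assume "p \<in> map_prod chart chart ` parcs G"
  then obtain x y where p: "p = (chart x, chart y)" and xy: "adj x y"
    by (auto simp: adj_def)
  have x: "x \<in> V" and y: "y \<in> V" using adj_V[OF xy] by simp_all
  show "p \<in> parcs (bundle_graph base (hypercube rank) transport)"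
  proof (cases "flat x y")
    case True
    have f: "flat (top x) (top y)" by (rule flat_top[OF True])
    have "transport (top x) (top y) (code x) = code y"
      unfolding transport_def decode_code[OF top(2)[OF x] in_own_fibre[OF x]] move_eq[OF True refl] ..
    moreover have "(top x, top y) \<in> parcs base"
      using top(2)[OF x] top(2)[OF y] flat_adj(1)[OF f] by simp
    moreover have "code x \<in> pverts (hypercube rank)" by (simp add: hypercube_def)
    ultimately show ?thesis
      unfolding p chart_def bundle_graph_def by force
  next
    case False
    then have "top x = top y" using adj_cases[of x y] xy top_up[of x y] top_up[of y x] by auto
    then have "(code x, code y) \<in> parcs (hypercube rank)"
      using adj_code[OF top(2)[OF x] in_own_fibre[OF x], of y] xy y by (simp add: fibre_def)
    then show ?thesis
      unfolding p chart_def bundle_graph_def using \<open>top x = top y\<close> top(2)[OF y] by force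
  qed
next
  fix p assume "p \<in> parcs (bundle_graph base (hypercube rank) transport)"
  then consider s t u where "p = ((s, u), (t, transport s t u))" "(s, t) \<in> parcs base" "length u = rank"
    | t u v where "p = ((t, u), (t, v))" "summit t" "(u, v) \<in> parcs (hypercube rank)"
    by (auto simp: bundle_graph_def hypercube_def)
  then show "p \<in> map_prod chart chart ` parcs G"
  proof cases
    case (1 s t u)
    have s: "summit s" and f: "flat s t" using 1(2) summit_adj_flat by simp_all
    note d = decode[OF s 1(3)] and c = chart_decode[OF s 1(3)]
    have m: "flat (decode s u) (move (decode s u) t)" "top (move (decode s u) t) = t"
      using move[of "decode s u" t] fibreD[OF d(1)] f by simp_all
    have "p = map_prod chart chart (decode s u, move (decode s u) t)"
      unfolding 1(1) by (simp add: c(2)) (simp add: chart_def transport_def m(2))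
    moreover have "(decode s u, move (decode s u) t) \<in> parcs G"
      using flat_adj(1)[OF m(1)] by (simp add: adj_def)
    ultimately show ?thesis by (rule image_eqI)
  next
    case (2 t u v)
    have u: "length u = rank" and v: "length v = rank" using 2(3) by (simp_all add: hypercube_def)
    have "p = map_prod chart chart (decode t u, decode t v)"
      unfolding 2(1) using chart_decode(2)[OF 2(2) u] chart_decode(2)[OF 2(2) v] by simp
    moreover have "(decode t u, decode t v) \<in> parcs G"
      using adj_code[OF 2(2) decode(1)[OF 2(2) u] decode(1)[OF 2(2) v]] 2(3)
      unfolding decode(2)[OF 2(2) u] decode(2)[OF 2(2) v] by (simp add: adj_def)
    ultimately show ?thesis by (rule image_eqI)
  qed
qed

theorem hypercube_bundle: "is_bundle G (hypercube rank) base"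
  unfolding is_bundle_def
proof (intro exI conjI)
  show "bundle_data base (hypercube rank) transport" by (rule bundle_data_transport)
  let ?f = "\<lparr> iso_verts = chart, iso_arcs = map_prod chart chart, iso_head = snd, iso_tail = fst \<rparr>"
  have "pg.digraph_isomorphism ?f"
    unfolding pg.digraph_isomorphism_def
  proof (intro conjI)
    show "wf_digraph (with_proj G)" by (rule pg.wf_digraph_axioms)
    show "inj_on (iso_verts ?f) V" using chart_inj by simp
    have "inj_on (map_prod chart chart) (V \<times> V)" by (rule map_prod_inj_on[OF chart_inj chart_inj])
    then show "inj_on (iso_arcs ?f) (parcs G)"
      using adj_V by (auto simp: adj_def elim: inj_on_subset)
  qed (auto simp: map_prod_def split: prod.splits)
  moreover have "with_proj (bundle_graph base (hypercube rank) transport) = app_iso ?f (with_proj G)"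
    unfolding app_iso_def with_proj_def using chart_verts chart_arcs by simp
  ultimately show "digraph_iso (with_proj G) (with_proj (bundle_graph base (hypercube rank) transport))"
    unfolding digraph_iso_def by blast
qed

end

section \<open>Rank of the bundle and spectrum of the base\<close>

interpretation fun_space_pair: vector_space_pair
  "\<lambda>(c::real) (f::'a \<Rightarrow> real) x. c * f x" "\<lambda>(c::real) (f::'b \<Rightarrow> real) x. c * f x"
  by unfold_locales

context height_graph
begin

text \<open>
  An eigenfunction \<open>\<psi>\<close> is constant on flat edges, so the hypothesis says that it is constant on all edges at
  \<open>t\<close>. This property spreads to the adjacent vertices: if it holds at \<open>x\<close> and \<open>y z\<close> is an edge at a
  neighbour \<open>y\<close> of \<open>x\<close>, then \<open>y z\<close> is flat or lies with \<open>x y\<close> in a 4-cycle whose opposite edge is at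
  \<open>x\<close>, and the parallelogram law applies. A function that is constant on all edges has Laplacian
  0, and an eigenfunction to the eigenvalue 2 with Laplacian 0 is 0.
\<close>

lemma eigenfunction_determined_at_summit:
  assumes t: "summit t" and E: "\<psi> \<in> E" and flat_at: "\<And>b. b \<in> below t \<Longrightarrow> \<psi> b = \<psi> t"
  shows "\<psi> = 0"
proof -
  have flat_const: "\<psi> x = \<psi> y" if "flat x y" for x y
    using h_generic[OF E flat_adj(1)[OF that] flat_adj(3)[OF that]] .
  have still: "\<forall>w. adj x w \<longrightarrow> \<psi> w = \<psi> x" if x: "x \<in> V" for x
  proof (rule connected_induct[of t "\<lambda>x. \<forall>w. adj x w \<longrightarrow> \<psi> w = \<psi> x" x])
    show "\<forall>w. adj t w \<longrightarrow> \<psi> w = \<psi> t"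
    proof (intro allI impI)
      fix w assume "adj t w"
      then consider "up w t" | "flat t w" using adj_cases[of t w] t by (auto simp: summit_def)
      then show "\<psi> w = \<psi> t"
        by cases (use flat_at[of w] flat_const[of t w] in \<open>simp_all add: below_def\<close>)
    qed
  next
    fix x y assume IH: "\<forall>w. adj x w \<longrightarrow> \<psi> w = \<psi> x" and xy: "adj x y"
    show "\<forall>z. adj y z \<longrightarrow> \<psi> z = \<psi> y"
    proof (intro allI impI)
      fix z assume yz: "adj y z"
      \<comment> \<open>If \<open>x y\<close> is flat and \<open>y z\<close> is not, the square is spanned from the edge \<open>y z\<close> instead.\<close>
      consider "z = x" | "flat y z" | "z \<noteq> x" "h x \<noteq> h y" | "z \<noteq> x" "h y \<noteq> h z"
        using flat_def yz by metis
      then show "\<psi> z = \<psi> y"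
      proof cases
        case 1
        then show ?thesis using IH xy by simp
      next
        case 2
        then show ?thesis using flat_const by simp
      next
        case 3
        then have ne: "h y \<noteq> h x" by simp
        obtain w where w: "adj x w" "\<psi> y + \<psi> w = \<psi> x + \<psi> z"
        proof (rule square[OF adj_sym[OF xy] ne yz 3(1)])
          fix w assume "adj x w" and "\<And>\<psi>. \<psi> \<in> E \<Longrightarrow> \<psi> y + \<psi> w = \<psi> x + \<psi> z"
          then show thesis using that[of w] E by simp
        qed
        then show ?thesis using IH by simp
      next
        case 4
        obtain w where w: "adj x w" "\<psi> y + \<psi> w = \<psi> z + \<psi> x"
        proof (rule square[OF yz 4(2) adj_sym[OF xy]])
          show "x \<noteq> z" using 4(1) by simp
          fix w assume "adj x w" and "\<And>\<psi>. \<psi> \<in> E \<Longrightarrow> \<psi> y + \<psi> w = \<psi> z + \<psi> x"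
          then show thesis using that[of w] E by simp
        qed
        then show ?thesis using IH by simp
      qed
    qed
  qed (use summit_V[OF t] x in simp_all)
  have "\<psi> x = 0" for x
  proof (cases "x \<in> V")
    case True
    have "Laplacian G \<psi> x = 0"
      unfolding Laplacian_eq by (intro sum.neutral) (use still[OF True] in \<open>auto simp: A_def\<close>)
    then show ?thesis using eigenspaceD(1)[OF E, of x] by simp
  qed (rule eigenspaceD(2)[OF E])
  then show ?thesis by auto
qed

lemma eigenspace_subspace: "fun_space.subspace (eigenspace G \<mu>)"
proof (rule fun_space.subspaceI)
  show "0 \<in> eigenspace G \<mu>" using eigenspace_zero[of \<mu>] by (simp add: zero_fun_def)
  show "f + g \<in> eigenspace G \<mu>" if "f \<in> eigenspace G \<mu>" "g \<in> eigenspace G \<mu>" for f g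
    using eigenspace_add_scaled[OF that, of 1] by (simp add: plus_fun_def)
  show "(\<lambda>x. c * f x) \<in> eigenspace G \<mu>" if "f \<in> eigenspace G \<mu>" for c f
    using eigenspace_add_scaled[OF eigenspace_zero that, of c] by simp
qed

text \<open>
  The differences along the edges below one summit define an injective linear map from the eigenspace
  to a space with as many coordinates as the rank.
\<close>

lemma eigenvalue_mult_le_rank: "eigenvalue_mult G 2 \<le> rank"
proof -
  obtain t where t: "summit t" using V_nonempty top(2) by blast
  define T where "T = (\<lambda>(\<psi> :: 'a \<Rightarrow> real) b. if b \<in> below t then \<psi> b - \<psi> t else 0)"
  have lin: "Vector_Spaces.linear (\<lambda>(c::real) f x. c * f x) (\<lambda>(c::real) f x. c * f x) T"
    by unfold_locales (auto simp: T_def fun_eq_iff algebra_simps)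
  obtain B where B: "B \<subseteq> E" "fun_space.independent B" "E \<subseteq> fun_space.span B" "card B = fun_space.dim E"
    using fun_space.basis_exists[of E] by metis
  have span: "fun_space.span B \<subseteq> E"
    by (rule fun_space.span_minimal[OF B(1) eigenspace_subspace])
  have inj: "inj_on T (fun_space.span B)"
  proof (rule inj_onI)
    fix f g assume f: "f \<in> fun_space.span B" and g: "g \<in> fun_space.span B" and eq: "T f = T g"
    have "(\<lambda>u. f u + (-1) * g u) \<in> E"
      using f g span by (intro eigenspace_add_scaled) auto
    moreover have "f b + (-1) * g b = f t + (-1) * g t" if "b \<in> below t" for b
      using fun_cong[OF eq, of b] that by (simp add: T_def)
    ultimately have "(\<lambda>u. f u + (-1) * g u) = 0"
      by (rule eigenfunction_determined_at_summit[OF t])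
    then show "f = g" by (auto simp: fun_eq_iff)
  qed
  have "fun_space.independent (T ` B)"
    using fun_space_pair.linear_independent_injective_image[OF lin B(2) inj] .
  moreover have "T ` B \<subseteq> fun_space.span (unit_fun ` below t)"
    by (auto intro!: supported_in_span simp: T_def)
  ultimately have "card (T ` B) \<le> card (unit_fun ` below t)"
    using fun_space.independent_span_bound[of "unit_fun ` below t" "T ` B"] by simp
  also have "\<dots> \<le> card (below t)" by (rule card_image_le) simp
  also have "card (T ` B) = card B"
    by (rule card_image) (rule inj_on_subset[OF inj fun_space.span_superset])
  finally show ?thesis
    using B(4) card_below_rank[OF t] by (simp add: eigenvalue_mult_def)
qed

lemma eigenspace_lift:
  assumes f: "f \<in> eigenspace base \<mu>"
  shows "(\<lambda>x. if x \<in> V then f (top x) else 0) \<in> eigenspace G \<mu>"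
proof (rule eigenspaceI)
  fix x assume x: "x \<in> V"
  have "Laplacian G (\<lambda>x. if x \<in> V then f (top x) else 0) x = Laplacian G (\<lambda>x. f (top x)) x"
    by (rule Laplacian_cong[OF x]) simp
  also have "\<dots> = Laplacian base f (top x)" by (rule Laplacian_base[OF x])
  also have "\<dots> = - \<mu> * f (top x)" by (rule base.eigenspaceD(1)[OF f])
  finally show "- Laplacian G (\<lambda>x. if x \<in> V then f (top x) else 0) x = \<mu> * (if x \<in> V then f (top x) else 0)"
    using x by simp
qed simp

text \<open>
  The lift of an eigenfunction of the base is constant on each fibre, in particular on the edges below
  a summit; if the eigenvalue were 2, it would be 0.
\<close>

lemma base_eigenvalues:
  assumes \<mu>: "\<mu> \<in> eigenvalues base"
  shows "\<mu> \<in> eigenvalues G" "\<mu> \<noteq> 2"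
proof -
  obtain f where f: "f \<in> eigenspace base \<mu>" "f \<noteq> 0" using \<mu> by (auto simp: eigenvalues_def)
  define F where "F = (\<lambda>x. if x \<in> V then f (top x) else 0)"
  have F: "F \<in> eigenspace G \<mu>" unfolding F_def by (rule eigenspace_lift[OF f(1)])
  obtain s where s: "f s \<noteq> 0" using f(2) by (auto simp: fun_eq_iff)
  then have "summit s" using base.eigenspaceD(2)[OF f(1), of s] by auto
  then have "F s \<noteq> 0" using s by (simp add: F_def summit_V top_summit)
  then have F0: "F \<noteq> 0" by (auto simp: fun_eq_iff)
  show "\<mu> \<in> eigenvalues G" using F F0 by (auto simp: eigenvalues_def)
  show "\<mu> \<noteq> 2"
  proof
    assume "\<mu> = 2"
    then have FE: "F \<in> E" using F by simp
    have "F b = F s" if "b \<in> below s" for b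
      using that top_below[OF \<open>summit s\<close> that] up_V[of b s] top_summit[OF \<open>summit s\<close>]
      by (simp add: F_def below_def)
    then have "F = 0" by (rule eigenfunction_determined_at_summit[OF \<open>summit s\<close> FE])
    then show False using F0 by simp
  qed
qed

end

theorem theorem1p3:
  fixes G :: "'a pair_pre_digraph" and d :: nat
  assumes "connected_graph G"
    and "regular_graph G d"
    and "Lichnerowicz_sharp G"
  shows "\<exists>(G' :: 'a pair_pre_digraph) (r :: nat).
    connected_graph G' \<and>
    r \<ge> eigenvalue_mult G 2 \<and>
    is_bundle G (hypercube r) G' \<and>
    CD_inf G' 2 \<and>
    (card (pverts G') > 1 \<longrightarrow> lambda1 G' > 2)"
proof -
  interpret regular_pair_graph G d
    by unfold_locales (rule assms)+
  obtain K where K: "card V > 1" "K > 0" "CD_inf G K" "lambda1 G = K"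
    using assms(3) unfolding Lichnerowicz_sharp_def by blast
  note least = lambda1_least[OF K(1)]
  obtain \<phi> where \<phi>: "\<phi> \<in> eigenspace G K" "\<phi> \<noteq> 0"
    using least(1) K(4) by (auto simp: eigenvalues_def)
  then obtain x where "\<phi> x \<noteq> 0" by (auto simp: fun_eq_iff)
  then have K2: "K = 2" by (rule sharp_curvature_eq_2[OF K(3) \<phi>(1) _ K(2)])
  interpret regular_CD2_graph G d
    by unfold_locales (use K(3) K2 in simp)
  obtain h where h: "h \<in> E" "\<And>\<psi> x y. \<psi> \<in> E \<Longrightarrow> adj x y \<Longrightarrow> h x = h y \<Longrightarrow> \<psi> x = \<psi> y"
  proof (rule generic_eigenfunction[where \<mu> = 2])
    fix h assume "h \<in> E" "\<And>\<psi> x y. \<psi> \<in> E \<Longrightarrow> adj x y \<Longrightarrow> h x = h y \<Longrightarrow> \<psi> x = \<psi> y"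
    then show thesis by (rule that)
  qed
  interpret height_graph G d h
    by unfold_locales (fact h)+
  have "lambda1 base > 2" if "card (pverts base) > 1"
  proof -
    note l = base.lambda1_least[OF that]
    have "lambda1 base \<in> eigenvalues G" "lambda1 base \<noteq> 2"
      using base_eigenvalues[OF l(1)] by simp_all
    then show ?thesis using least(3)[of "lambda1 base"] l(2) K(4) K2 by simp
  qed
  then show ?thesis
    using connected_base eigenvalue_mult_le_rank hypercube_bundle CD2_base by blast
qed

end
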